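(* Consider the task scheduling system, the optimization problem (P), the virtual queues, and the task scheduling algorithm with parameter $V$ described in the context. Suppose $Q_n[0]=0$ for all $n\in\{1,\ldots,N\}$ and that problem (P) is feasible. Let $power^{opt}$ denote the minimum time average power for problem (P). Let $B$ be a constant satisfying, for all frames $k$, all possible $\boldsymbol{Q}[k]$ and all policies, $$B\ \ge\ \frac12\sum_{n=1}^N\mathbb{E}\left[(\lambda_n(D[k]+I[k])-1_n[k])^2\,\middle|\,\boldsymbol{Q}[k]\right].$$ For each $K\in\{1,2,3,\ldots\}$ define $\overline{e}[K]=\frac1K\sum_{k=0}^{K-1}\mathbb{E}[e[k]]$, $\overline{D}[K]=\frac1K\sum_{k=0}^{K-1}\mathbb{E}[D[k]]$, $\overline{I}[K]=\frac1K\sum_{k=0}^{K-1}\mathbb{E}[I[k]]$, $\overline{1}_n[K]=\frac1K\sum_{k=0}^{K-1}\mathbb{E}[1_n[k]]$. Then under the task scheduling algorithm: (a) If $V>0$, then for all $K\in\{1,2,3,\ldots\}$: $$\frac{\overline{e}[K]}{\overline{D}[K]+\overline{I}[K]}\ \le\ power^{opt}+\frac{B}{V(\overline{D}[K]+\overline{I}[K])}.$$ (b) For $V\ge 0$ and for all $n\in\{1,\ldots,N\}$: $$\limsup_{K\to\infty}\frac1K\sum_{k=0}^{K-1}\left[\lambda_n(D[k]+I[k])-1_n[k]\right]\le 0\quad\text{with probability 1},$$ $$\limsup_{K\to\infty}\left[\lambda_n(\overline{D}[K]+\overline{I}[K])-\overline{1}_n[K]\right]\le 0 .$$ Further, for each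 $K\in\{1,2,3,\ldots\}$: $$\frac{\mathbb{E}\left[\|\boldsymbol{Q}[K]\|\right]}{K}\ \le\ \sqrt{\frac{2(B+V\beta)}{K}},$$ where $\|\boldsymbol{Q}[k]\|=\sqrt{\sum_{n=1}^N Q_n[k]^2}$ and $\beta$ is any constant satisfying $\beta\ge\mathbb{E}\left[power^{opt}(D[k]+I[k])-e[k]\right]$ for all frames $k$ (such a constant exists).
   Context: System. Time is divided into frames $k\in\{0,1,2,\ldots\}$. There are $N$ task classes ($N$ a positive integer), a finite nonempty set $\mathcal{M}$ of processing modes, and a constant $I_{max}>0$. On each frame $k$ a controller chooses a class $c[k]\in\{1,\ldots,N\}$, a mode $m[k]\in\mathcal{M}$ and an idle time $I[k]$ with $0\le I[k]\le I_{max}$. Choices may be randomized and may depend on the past (a rule for making them is a policy). Frame $k$ has an active period of random duration $D[k]$ using random energy $e[k]$, followed by an idle period of duration $I[k]$ using no energy; the frame size is $D[k]+I[k]$. The pair $(D[k],e[k])$ is conditionally independent of the past given $(c[k],m[k])$, its conditional distribution given $(c[k],m[k])$ does not depend on the policy, and its conditional means are $$\hat D(c,m)=\mathbb{E}[D[k]\mid (c[k],m[k])=(c,m)],\qquad \hat e(c,m)=\mathbb{E}[e[k]\mid (c[k],m[k])=(c,m)].$$ There are constants $D_{min}>0$ and $\sigma^2<\infty$ such that $D[k]\ge D_{min}$ always, and $\mathbb{E}[D[k]^2]\le\sigma^2$, $\mathbb{E}[e[k]^2]\le\sigma^2$ for all $k$ under every policy for selecting $(c[k],m[k])$ (including those that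 always select one fixed pair). The conditional joint distribution is otherwise arbitrary. Let $1_n[k]=1$ if $c[k]=n$ and $1_n[k]=0$ otherwise. Because of the second moment bounds, a finite constant $B$ as in the claim exists. Problem (P). For given constants $\lambda_1,\ldots,\lambda_N$ (desired processing rates): minimize $\overline{e}/(\overline{D}+\overline{I})$ subject to $\overline{1}_n/(\overline{D}+\overline{I})\ge\lambda_n$ for all $n\in\{1,\ldots,N\}$, $(c[k],m[k])\in\{1,\ldots,N\}\times\mathcal{M}$ and $0\le I[k]\le I_{max}$ for all $k$. Here $\overline{e},\overline{D},\overline{I},\overline{1}_n$ are the frame averages $\lim_{K\to\infty}\frac1K\sum_{k=0}^{K-1}(\cdot)[k]$ of $e[k],D[k],I[k],1_n[k]$, and the policies considered are those for which these limits converge to constants with probability 1. (P) is feasible if some such policy satisfies all the constraints, and $power^{opt}$ is the minimum value of the objective over such policies. Virtual queues. $Q_n[k+1]=\max[Q_n[k]+\lambda_n(D[k]+I[k])-1_n[k],\,0]$ for $n\in\{1,\ldots,N\}$, and $\boldsymbol{Q}[k]=(Q_1[k],\ldots,Q_N[k])$. Task scheduling algorithm (parameter $V\ge0$). On every frame $k$, observe $\boldsymbol{Q}[k]$ and choose $c[k]\in\{1,\ldots,N\}$, $m[k]\in\mathcal{M}$, $I[k]\in[0,I_{max}]$ to minimize $$\frac{V\hat e(c[k],m[k])-Q_{c[k]}[k]}{\hat D(c[k],m[k])+I[k]},$$ breaking ties arbitrarily; then update the virtual queues using the resulting $D[k]$, $I[k]$, $1_n[k]$. *)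

theory Defs
  imports "HOL-Probability.Probability"
begin

(* outcome_law S c m is the joint law of (duration, energy) of a frame with class c and mode m. *)
record 'm task_system =
  num_classes :: nat
  modes :: "'m set"
  max_idle :: real
  min_active :: real
  moment_bound :: real
  outcome_law :: "nat \<Rightarrow> 'm \<Rightarrow> (real \<times> real) measure"

type_synonym 'm choice = "nat \<times> 'm \<times> real"
type_synonym outcome = "real \<times> real"
type_synonym 'm path = "nat \<Rightarrow> 'm choice \<times> outcome"

definition classes :: "'m task_system \<Rightarrow> nat set" where
  "classes S = {1..num_classes S}"

definition choices :: "'m task_system \<Rightarrow> 'm choice set" where
  "choices S = classes S \<times> modes S \<times> {0..max_idle S}"

definition choice_space :: "'m task_system \<Rightarrow> 'm choice measure" where
  "choice_space S =
     count_space (classes S) \<Otimes>\<^sub>M (count_space (modes S) \<Otimes>\<^sub>M restrict_space borel {0..max_idle S})"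

definition outcome_space :: "'m task_system \<Rightarrow> outcome measure" where
  "outcome_space S = restrict_space borel {min_active S..} \<Otimes>\<^sub>M borel"

definition frame_space :: "'m task_system \<Rightarrow> ('m choice \<times> outcome) measure" where
  "frame_space S = choice_space S \<Otimes>\<^sub>M outcome_space S"

definition path_space :: "'m task_system \<Rightarrow> 'm path measure" where
  "path_space S = Pi\<^sub>M UNIV (\<lambda>_. frame_space S)"

definition chosen :: "nat \<Rightarrow> 'm path \<Rightarrow> 'm choice" where
  "chosen k \<omega> = fst (\<omega> k)"

definition chosen_class :: "nat \<Rightarrow> 'm path \<Rightarrow> nat" where
  "chosen_class k \<omega> = fst (chosen k \<omega>)"

definition chosen_mode :: "nat \<Rightarrow> 'm path \<Rightarrow> 'm" where
  "chosen_mode k \<omega> = fst (snd (chosen k \<omega>))"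

definition idle :: "nat \<Rightarrow> 'm path \<Rightarrow> real" where
  "idle k \<omega> = snd (snd (chosen k \<omega>))"

definition active :: "nat \<Rightarrow> 'm path \<Rightarrow> real" where
  "active k \<omega> = fst (snd (\<omega> k))"

definition energy :: "nat \<Rightarrow> 'm path \<Rightarrow> real" where
  "energy k \<omega> = snd (snd (\<omega> k))"

definition served :: "nat \<Rightarrow> nat \<Rightarrow> 'm path \<Rightarrow> real" where
  "served n k \<omega> = (if chosen_class k \<omega> = n then 1 else 0)"

(* The sigma-algebra generated by the frames before k and the choice made on frame k. *)
definition decision_info :: "'m task_system \<Rightarrow> nat \<Rightarrow> 'm path measure" where
  "decision_info S k =
     vimage_algebra (space (path_space S)) (\<lambda>\<omega>. (restrict \<omega> {..<k}, chosen k \<omega>))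
       (Pi\<^sub>M {..<k} (\<lambda>_. frame_space S) \<Otimes>\<^sub>M choice_space S)"

(* A policy is represented by the law it induces on paths.  Choices are unrestricted (they may be
   randomized and may depend on earlier frames) apart from the ranges built into path_space; the condition says that, given the past and the
   current choice, the outcome of frame k has law outcome_law S c m, where (c, m) is the chosen
   pair.  Private randomness of the controller needs no component of its own: averaging it out
   leaves a path law of this form. *)
definition policy :: "'m task_system \<Rightarrow> 'm path measure \<Rightarrow> bool" where
  "policy S P \<longleftrightarrow>
     prob_space P \<and> sets P = sets (path_space S) \<and>
     (\<forall>k. \<forall>A\<in>sets (outcome_space S). AE \<omega> in P.
        real_cond_exp P (decision_info S k) (\<lambda>\<omega>. indicator A (active k \<omega>, energy k \<omega>)) \<omega>
          = measure (outcome_law S (chosen_class k \<omega>) (chosen_mode k \<omega>)) A)"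

definition task_system :: "'m task_system \<Rightarrow> bool" where
  "task_system S \<longleftrightarrow>
     num_classes S \<ge> 1 \<and> finite (modes S) \<and> modes S \<noteq> {} \<and> max_idle S > 0 \<and> min_active S > 0 \<and>
     (\<forall>c\<in>classes S. \<forall>m\<in>modes S.
        prob_space (outcome_law S c m) \<and> sets (outcome_law S c m) = sets (outcome_space S)) \<and>
     (\<forall>P k. policy S P \<longrightarrow>
        integrable P (\<lambda>\<omega>. (active k \<omega>)\<^sup>2) \<and> (\<integral>\<omega>. (active k \<omega>)\<^sup>2 \<partial>P) \<le> moment_bound S \<and>
        integrable P (\<lambda>\<omega>. (energy k \<omega>)\<^sup>2) \<and> (\<integral>\<omega>. (energy k \<omega>)\<^sup>2 \<partial>P) \<le> moment_bound S)"

definition mean_active :: "'m task_system \<Rightarrow> nat \<Rightarrow> 'm \<Rightarrow> real" where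
  "mean_active S c m = (\<integral>x. fst x \<partial>outcome_law S c m)"

definition mean_energy :: "'m task_system \<Rightarrow> nat \<Rightarrow> 'm \<Rightarrow> real" where
  "mean_energy S c m = (\<integral>x. snd x \<partial>outcome_law S c m)"

definition avg :: "nat \<Rightarrow> (nat \<Rightarrow> real) \<Rightarrow> real" where
  "avg K x = (1 / real K) * (\<Sum>k<K. x k)"

definition has_frame_average :: "'m path measure \<Rightarrow> (nat \<Rightarrow> 'm path \<Rightarrow> real) \<Rightarrow> real \<Rightarrow> bool" where
  "has_frame_average P X l \<longleftrightarrow> (AE \<omega> in P. (\<lambda>K. avg K (\<lambda>k. X k \<omega>)) \<longlonglongrightarrow> l)"

(* The time average powers of the policies whose processing rates are at least the desired ones;
   n-th rate = s n / (D + I). *)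
definition attainable_powers :: "'m task_system \<Rightarrow> (nat \<Rightarrow> real) \<Rightarrow> real set" where
  "attainable_powers S rate =
     {e / (D + I) | e D I. \<exists>P s.
        policy S P \<and> has_frame_average P energy e \<and> has_frame_average P active D \<and>
        has_frame_average P idle I \<and>
        (\<forall>n\<in>classes S. has_frame_average P (served n) (s n) \<and> s n / (D + I) \<ge> rate n)}"

definition feasible :: "'m task_system \<Rightarrow> (nat \<Rightarrow> real) \<Rightarrow> bool" where
  "feasible S rate \<longleftrightarrow> attainable_powers S rate \<noteq> {}"

(* For a feasible problem the set is nonempty and, by the second moment bounds, bounded below. *)
definition power_opt :: "'m task_system \<Rightarrow> (nat \<Rightarrow> real) \<Rightarrow> real" where
  "power_opt S rate = Inf (attainable_powers S rate)"

definition net_arrival :: "(nat \<Rightarrow> real) \<Rightarrow> nat \<Rightarrow> nat \<Rightarrow> 'm path \<Rightarrow> real" where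
  "net_arrival rate n k \<omega> = rate n * (active k \<omega> + idle k \<omega>) - served n k \<omega>"

primrec queue :: "(nat \<Rightarrow> real) \<Rightarrow> (nat \<Rightarrow> real) \<Rightarrow> nat \<Rightarrow> nat \<Rightarrow> 'm path \<Rightarrow> real" where
  "queue rate Q0 n 0 \<omega> = Q0 n"
| "queue rate Q0 n (Suc k) \<omega> = max (queue rate Q0 n k \<omega> + net_arrival rate n k \<omega>) 0"

definition queue_norm :: "'m task_system \<Rightarrow> (nat \<Rightarrow> real) \<Rightarrow> (nat \<Rightarrow> real) \<Rightarrow> nat \<Rightarrow> 'm path \<Rightarrow> real" where
  "queue_norm S rate Q0 k \<omega> = sqrt (\<Sum>n\<in>classes S. (queue rate Q0 n k \<omega>)\<^sup>2)"

(* The sigma-algebra generated by the queue vector of frame k. *)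
definition queue_info :: "'m task_system \<Rightarrow> (nat \<Rightarrow> real) \<Rightarrow> (nat \<Rightarrow> real) \<Rightarrow> nat \<Rightarrow> 'm path measure" where
  "queue_info S rate Q0 k =
     vimage_algebra (space (path_space S)) (\<lambda>\<omega>. \<lambda>n\<in>classes S. queue rate Q0 n k \<omega>)
       (Pi\<^sub>M (classes S) (\<lambda>_. borel))"

definition drift_bound :: "'m task_system \<Rightarrow> (nat \<Rightarrow> real) \<Rightarrow> (nat \<Rightarrow> real) \<Rightarrow> real \<Rightarrow> bool" where
  "drift_bound S rate Q0 B \<longleftrightarrow>
     (\<forall>P k. policy S P \<longrightarrow>
        (AE \<omega> in P. B \<ge> 1 / 2 *
           (\<Sum>n\<in>classes S.
              real_cond_exp P (queue_info S rate Q0 k) (\<lambda>\<omega>. (net_arrival rate n k \<omega>)\<^sup>2) \<omega>)))"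

definition scheduling_index ::
  "'m task_system \<Rightarrow> real \<Rightarrow> (nat \<Rightarrow> real) \<Rightarrow> 'm choice \<Rightarrow> real" where
  "scheduling_index S V q = (\<lambda>(c, m, i). (V * mean_energy S c m - q c) / (mean_active S c m + i))"

(* The path laws that can result from the algorithm, one for each way of breaking ties. *)
definition scheduling_policy ::
  "'m task_system \<Rightarrow> (nat \<Rightarrow> real) \<Rightarrow> (nat \<Rightarrow> real) \<Rightarrow> real \<Rightarrow> 'm path measure \<Rightarrow> bool" where
  "scheduling_policy S rate Q0 V P \<longleftrightarrow>
     policy S P \<and>
     (AE \<omega> in P. \<forall>k. is_arg_min (scheduling_index S V (\<lambda>n. queue rate Q0 n k \<omega>))
        (\<lambda>a. a \<in> choices S) (chosen k \<omega>))"

definition mean_avg :: "'m path measure \<Rightarrow> (nat \<Rightarrow> 'm path \<Rightarrow> real) \<Rightarrow> nat \<Rightarrow> real" where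
  "mean_avg P X K = avg K (\<lambda>k. \<integral>\<omega>. X k \<omega> \<partial>P)"

end

theory Submission
  imports Defs "HOL-Library.Discrete_Functions"
begin

text \<open>
  The algorithm minimizes an index over all choices.  Averaging the minimality inequality along a
  typical path of an arbitrary admissible policy shows that the minimal index \<open>\<theta>\<close> for queue vector \<open>q\<close>
  satisfies \<open>\<theta> \<le> V p - \<Sum>\<^sub>n q\<^sub>n \<lambda>\<^sub>n\<close> for every attainable power \<open>p\<close>, hence for the infimum; this needs neither
  an optimal stationary policy nor Caratheodory's theorem.  Inserted into the drift of \<open>\<Sum>\<^sub>n Q\<^sub>n\<^sup>2\<close> and
  telescoped, it gives both the power bound and a linear bound for the second moments of the queues.

  Almost sure statements are derived from second moments only.  A process with \<open>E M\<^sub>K\<^sup>2 \<le> C K\<close> satisfies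
  \<open>M\<^sub>K / K \<longlonglongrightarrow> 0\<close> along the squares \<open>K = j\<^sup>2\<close>, since \<open>C / j\<^sup>2\<close> is summable.  For the martingale of
  deviations of the outcomes from their conditional means this subsequence suffices, because the
  frame averages are assumed to converge; for the queues the gaps between squares are bridged by
  second moments of the increments.
\<close>

subsection \<open>Second moments and almost sure convergence\<close>

lemma integrable_mult_of_squares:
  fixes f g :: "'a \<Rightarrow> real"
  assumes [measurable]: "f \<in> borel_measurable M" "g \<in> borel_measurable M"
    and "integrable M (\<lambda>x. (f x)\<^sup>2)" "integrable M (\<lambda>x. (g x)\<^sup>2)"
  shows "integrable M (\<lambda>x. f x * g x)"
proof (rule Bochner_Integration.integrable_bound[where f = "\<lambda>x. (f x)\<^sup>2 + (g x)\<^sup>2"])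
  have "\<bar>a * b\<bar> \<le> a\<^sup>2 + b\<^sup>2" for a b :: real
  proof -
    have "2 * (\<bar>a\<bar> * \<bar>b\<bar>) \<le> a\<^sup>2 + b\<^sup>2"
      using sum_squares_bound[of "\<bar>a\<bar>" "\<bar>b\<bar>"] by simp
    moreover have "0 \<le> \<bar>a\<bar> * \<bar>b\<bar>" by simp
    ultimately show ?thesis unfolding abs_mult by linarith
  qed
  then show "AE x in M. norm (f x * g x) \<le> norm ((f x)\<^sup>2 + (g x)\<^sup>2)"
    by simp
qed (use assms in auto)

lemma integrable_square_add:
  fixes f g :: "'a \<Rightarrow> real"
  assumes [measurable]: "f \<in> borel_measurable M" "g \<in> borel_measurable M"
    and "integrable M (\<lambda>x. (f x)\<^sup>2)" "integrable M (\<lambda>x. (g x)\<^sup>2)"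
  shows "integrable M (\<lambda>x. (f x + g x)\<^sup>2)"
  using integrable_mult_of_squares[OF assms] assms(3,4)
  unfolding power2_sum mult.assoc by auto

text \<open>Jensen's inequality for the square, read off from the nonnegativity of the variance of
  \<open>\<bar>X\<bar>\<close>.\<close>

lemma (in prob_space) expectation_abs_le_square:
  fixes X :: "'a \<Rightarrow> real"
  assumes [measurable]: "X \<in> borel_measurable M" and "integrable M (\<lambda>x. (X x)\<^sup>2)"
  shows "expectation (\<lambda>x. \<bar>X x\<bar>) \<le> sqrt (expectation (\<lambda>x. (X x)\<^sup>2))"
proof -
  have "0 \<le> variance (\<lambda>x. \<bar>X x\<bar>)" by (rule variance_positive)
  also have "variance (\<lambda>x. \<bar>X x\<bar>) = expectation (\<lambda>x. \<bar>X x\<bar>\<^sup>2) - (expectation (\<lambda>x. \<bar>X x\<bar>))\<^sup>2"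
    by (rule variance_eq) (use assms square_integrable_imp_integrable[OF assms] in auto)
  finally show ?thesis by (intro real_le_rsqrt) simp
qed

text \<open>The rate \<open>1 / (j + 1)\<^sup>2\<close> is summable, so the sum of the squares is almost surely finite.\<close>
lemma AE_tendsto_zero_of_square_moments:
  fixes X :: "nat \<Rightarrow> 'a \<Rightarrow> real"
  assumes [measurable]: "\<And>j. X j \<in> borel_measurable M"
    and int: "\<And>j. integrable M (\<lambda>x. (X j x)\<^sup>2)"
    and le: "\<And>j. (\<integral>x. (X j x)\<^sup>2 \<partial>M) \<le> C / (real j + 1)\<^sup>2"
  shows "AE x in M. (\<lambda>j. X j x) \<longlonglongrightarrow> 0"
proof -
  have "summable (\<lambda>j. 1 / (real (Suc j))\<^sup>2)"
    using inverse_power_summable[of 2, where 'a = real] 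
    by (subst summable_Suc_iff) (simp add: field_simps)
  then have sm: "summable (\<lambda>j. C / (real j + 1)\<^sup>2)"
    using summable_mult[of "\<lambda>j. 1 / (real (Suc j))\<^sup>2" C] by (simp add: add.commute)
  have nonneg: "0 \<le> C / (real j + 1)\<^sup>2" for j
    by (rule order_trans[OF _ le]) simp
  have "(\<integral>\<^sup>+x. (\<Sum>j. ennreal ((X j x)\<^sup>2)) \<partial>M) = (\<Sum>j. \<integral>\<^sup>+x. ennreal ((X j x)\<^sup>2) \<partial>M)"
    by (rule nn_integral_suminf) measurable
  also have "\<dots> \<le> (\<Sum>j. ennreal (C / (real j + 1)\<^sup>2))"
    by (intro suminf_le) (auto simp: nn_integral_eq_integral[OF int] intro!: ennreal_leI le)
  also have "\<dots> = ennreal (\<Sum>j. C / (real j + 1)\<^sup>2)"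
    by (rule suminf_ennreal2[OF nonneg sm])
  finally have "(\<integral>\<^sup>+x. (\<Sum>j. ennreal ((X j x)\<^sup>2)) \<partial>M) \<noteq> \<infinity>"
    by (auto simp: top_unique)
  then have "AE x in M. (\<Sum>j. ennreal ((X j x)\<^sup>2)) \<noteq> \<infinity>"
    by (intro nn_integral_noteq_infinite) auto
  then show ?thesis
  proof eventually_elim
    case (elim x)
    then have "summable (\<lambda>j. (X j x)\<^sup>2)"
      by (intro summable_suminf_not_top) auto
    then have "(\<lambda>j. (X j x)\<^sup>2) \<longlonglongrightarrow> 0" by (rule summable_LIMSEQ_zero)
    then show ?case using tendsto_rabs_zero_iff[of "\<lambda>j. X j x" sequentially] tendsto_real_sqrt[of "\<lambda>j. (X j x)\<^sup>2" 0 sequentially] by simp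
  qed
qed

text \<open>Normalizing by \<open>K\<close> leaves a second moment of at most \<open>C / K\<close>.
  This need not be summable over all \<open>K\<close>, but it is over the squares, which is why the
  limit is claimed only along them.\<close>

lemma AE_square_subsequence:
  fixes M :: "nat \<Rightarrow> 'a \<Rightarrow> real"
  assumes [measurable]: "\<And>K. M K \<in> borel_measurable N"
    and int: "\<And>K. integrable N (\<lambda>x. (M K x)\<^sup>2)"
    and le: "\<And>K. (\<integral>x. (M K x)\<^sup>2 \<partial>N) \<le> real K * C"
  shows "AE x in N. (\<lambda>j. M ((j + 1)\<^sup>2) x / real ((j + 1)\<^sup>2)) \<longlonglongrightarrow> 0"
proof (rule AE_tendsto_zero_of_square_moments)
  fix j :: nat
  let ?r = "(j + 1)\<^sup>2"
  have r: "real ?r = (real j + 1)\<^sup>2" "0 < real ?r" by (simp_all add: add.commute)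
  show "(\<lambda>x. M ?r x / real ?r) \<in> borel_measurable N"
    by measurable
  show "integrable N (\<lambda>x. (M ?r x / real ?r)\<^sup>2)"
    unfolding power_divide using int by simp
  have "(\<integral>x. (M ?r x / real ?r)\<^sup>2 \<partial>N) = (\<integral>x. (M ?r x)\<^sup>2 \<partial>N) / (real ?r)\<^sup>2"
    unfolding power_divide by simp
  also have "\<dots> \<le> (real ?r * C) / (real ?r)\<^sup>2"
    by (intro divide_right_mono le) simp
  also have "\<dots> = C / real ?r"
    using r(2) unfolding power2_eq_square[of "real ?r"] by (simp only: mult_divide_mult_cancel_left_if) simp
  finally show "(\<integral>x. (M ?r x / real ?r)\<^sup>2 \<partial>N) \<le> C / (real j + 1)\<^sup>2"
    unfolding r(1) .
qed

text \<open>Along the squares \<open>Q\<close> is controlled by its own second moments, and between two consecutive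
  squares by those of the sum of the roughly \<open>2 j\<close> increments.\<close>
lemma AE_sublinear_of_square_moments:
  fixes Q X :: "nat \<Rightarrow> 'a \<Rightarrow> real"
  assumes [measurable]: "\<And>k. Q k \<in> borel_measurable N" "\<And>k. X k \<in> borel_measurable N"
    and Q_int: "\<And>K. integrable N (\<lambda>x. (Q K x)\<^sup>2)"
    and Q_le: "\<And>K. (\<integral>x. (Q K x)\<^sup>2 \<partial>N) \<le> real K * C"
    and X_int: "\<And>k. integrable N (\<lambda>x. (X k x)\<^sup>2)"
    and X_le: "\<And>k. (\<integral>x. (X k x)\<^sup>2 \<partial>N) \<le> D"
    and Q_nonneg: "\<And>k x. 0 \<le> Q k x"
    and step: "\<And>k x. Q (Suc k) x \<le> Q k x + \<bar>X k x\<bar>"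
  shows "AE x in N. (\<lambda>K. Q K x / real K) \<longlonglongrightarrow> 0"
proof -
  \<comment> \<open>The shift by one makes \<open>r 0 = 1\<close>, so every division by
    \<open>r j\<close> is a genuine one.\<close>
  define r :: "nat \<Rightarrow> nat" where "r j = (j + 1)\<^sup>2" for j
  have r_real: "real (r j) = (real j + 1)\<^sup>2" and r_pos: "0 < real (r j)" for j
    by (simp_all add: r_def add.commute)
  define A where "A j = {r j..<r (Suc j)}" for j
  \<comment> \<open>The total absolute increment over the block from \<open>r j\<close> to
    \<open>r (Suc j)\<close>; it bounds the rise of \<open>Q\<close> from \<open>r j\<close> to any
    index inside the block.\<close>
  define Z where "Z j x = (\<Sum>k\<in>A j. \<bar>X k x\<bar>)" for j x
  have [measurable]: "Z j \<in> borel_measurable N" for j unfolding Z_def by measurable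
  \<comment> \<open>The gap between the consecutive squares is \<open>2 * j + 3\<close>, rounded up
    to a multiple of \<open>j + 1\<close>.\<close>
  have card: "real (card (A j)) \<le> 3 * (real j + 1)" for j
    by (simp add: A_def r_def power2_eq_square algebra_simps)
  have Z_sq: "(Z j x)\<^sup>2 \<le> (\<Sum>k\<in>A j. (X k x)\<^sup>2) * (3 * (real j + 1))" for j x
  proof -
    have "(Z j x)\<^sup>2 \<le> (\<Sum>k\<in>A j. \<bar>X k x\<bar>\<^sup>2) * real (card (A j))"
      unfolding Z_def by (rule sum_squared_le_sum_of_squares)
    also have "\<dots> \<le> (\<Sum>k\<in>A j. \<bar>X k x\<bar>\<^sup>2) * (3 * (real j + 1))"
      by (intro mult_left_mono card sum_nonneg) simp
    finally show ?thesis by simp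
  qed
  have S_int: "integrable N (\<lambda>x. (\<Sum>k\<in>A j. (X k x)\<^sup>2) * (3 * (real j + 1)))" for j
    by (intro integrable_mult_left Bochner_Integration.integrable_sum X_int)
  have Z_int: "integrable N (\<lambda>x. (Z j x)\<^sup>2)" for j
    by (rule Bochner_Integration.integrable_bound[OF S_int[of j]])
      (auto intro!: AE_I2 order_trans[OF Z_sq] simp: abs_mult)
  have D_nonneg: "0 \<le> D"
    by (rule order_trans[OF _ X_le[of 0]]) simp
  \<comment> \<open>One factor \<open>3 * (j + 1)\<close> comes from Cauchy-Schwarz, the other from
    the number of summands. The product is of order \<open>r j\<close>, so that division by the
    square of \<open>r j\<close> leaves a summable rate.\<close>
  have Z_le: "(\<integral>x. (Z j x)\<^sup>2 \<partial>N) \<le> 9 * D * real (r j)" for j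
  proof -
    have "(\<integral>x. (Z j x)\<^sup>2 \<partial>N) \<le> (\<integral>x. (\<Sum>k\<in>A j. (X k x)\<^sup>2) * (3 * (real j + 1)) \<partial>N)"
      by (rule integral_mono[OF Z_int S_int Z_sq])
    also have "\<dots> = (\<Sum>k\<in>A j. \<integral>x. (X k x)\<^sup>2 \<partial>N) * (3 * (real j + 1))"
      using X_int by (simp add: Bochner_Integration.integral_sum)
    also have "\<dots> \<le> (real (card (A j)) * D) * (3 * (real j + 1))"
      by (intro mult_right_mono sum_bounded_above X_le) simp
    also have "\<dots> \<le> (3 * (real j + 1) * D) * (3 * (real j + 1))"
      by (intro mult_right_mono card D_nonneg) simp
    also have "\<dots> = 9 * D * real (r j)"
      unfolding r_real by (simp add: power2_eq_square algebra_simps)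
    finally show ?thesis .
  qed
  have "AE x in N. (\<lambda>j. Z j x / real (r j)) \<longlonglongrightarrow> 0"
  proof (rule AE_tendsto_zero_of_square_moments)
    fix j
    show "(\<lambda>x. Z j x / real (r j)) \<in> borel_measurable N" by measurable
    show "integrable N (\<lambda>x. (Z j x / real (r j))\<^sup>2)"
      unfolding power_divide using Z_int by simp
    have "(\<integral>x. (Z j x / real (r j))\<^sup>2 \<partial>N) = (\<integral>x. (Z j x)\<^sup>2 \<partial>N) / (real (r j))\<^sup>2"
      unfolding power_divide by simp
    also have "\<dots> \<le> (9 * D * real (r j)) / (real (r j))\<^sup>2"
      by (intro divide_right_mono Z_le) simp
    also have "\<dots> = 9 * D / (real j + 1)\<^sup>2"
      using r_pos[of j] unfolding r_real[symmetric] power2_eq_square[of "real (r j)"] by simp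
    finally show "(\<integral>x. (Z j x / real (r j))\<^sup>2 \<partial>N) \<le> 9 * D / (real j + 1)\<^sup>2" .
  qed
  moreover have "AE x in N. (\<lambda>j. Q (r j) x / real (r j)) \<longlonglongrightarrow> 0"
    unfolding r_def by (rule AE_square_subsequence[OF _ Q_int Q_le]) measurable
  ultimately show ?thesis
  proof eventually_elim
    case (elim x)
    define W where "W j = Q (r j) x / real (r j) + Z j x / real (r j)" for j
    have W: "W \<longlonglongrightarrow> 0"
      unfolding W_def using tendsto_add[OF elim(2,1)] by simp
    have bound: "Q K x / real K \<le> W (floor_sqrt K - 1)" if "K \<ge> 1" for K
    proof -
      \<comment> \<open>This is the block containing \<open>K\<close>; the subtraction undoes the
        shift in \<open>r\<close>. Inside the block the divisor \<open>K\<close> may be replaced by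
        the smaller \<open>r j\<close>, because the numerator is nonnegative.\<close>
      define j where "j = floor_sqrt K - 1"
      have "j + 1 = floor_sqrt K" using that by (simp add: j_def Suc_leI)
      then have lower: "r j \<le> K" and upper: "K < r (Suc j)"
        unfolding r_def using Suc_floor_sqrt_power2_gt[of K] by simp_all
      have "Q i x \<le> Q (r j) x + (\<Sum>k\<in>{r j..<i}. \<bar>X k x\<bar>)" if "r j \<le> i" for i
        using that
      proof (induction i rule: dec_induct)
        case (step i)
        then show ?case using assms(8)[of i x] by (simp add: sum.atLeastLessThan_Suc)
      qed simp
      from this[OF lower] have "Q K x \<le> Q (r j) x + (\<Sum>k\<in>{r j..<K}. \<bar>X k x\<bar>)" .
      also have "(\<Sum>k\<in>{r j..<K}. \<bar>X k x\<bar>) \<le> Z j x"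
        unfolding Z_def A_def using upper by (intro sum_mono2) auto
      finally have "Q K x / real K \<le> (Q (r j) x + Z j x) / real K"
        by (simp add: divide_right_mono)
      also have "\<dots> \<le> (Q (r j) x + Z j x) / real (r j)"
        using lower r_pos[of j] Q_nonneg[of "r j" x]
        by (intro divide_left_mono add_nonneg_nonneg) (auto simp: Z_def sum_nonneg)
      finally show ?thesis by (simp add: W_def j_def add_divide_distrib)
    qed
    have "filterlim (\<lambda>K. floor_sqrt K - 1) sequentially sequentially"
      unfolding filterlim_at_top
    proof
      fix n :: nat
      show "\<forall>\<^sub>F K in sequentially. n \<le> floor_sqrt K - 1"
        using eventually_ge_at_top[of "(n + 1)\<^sup>2"]
      proof eventually_elim
        case (elim K)
        then have "n + 1 \<le> floor_sqrt K" by (rule le_floor_sqrtI)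
        then show ?case by simp
      qed
    qed
    from filterlim_compose[OF W this] have lim: "(\<lambda>K. W (floor_sqrt K - 1)) \<longlonglongrightarrow> 0" .
    show ?case
    proof (rule tendsto_sandwich[OF _ _ tendsto_const lim])
      show "\<forall>\<^sub>F K in sequentially. 0 \<le> Q K x / real K"
        using Q_nonneg by simp
      show "\<forall>\<^sub>F K in sequentially. Q K x / real K \<le> W (floor_sqrt K - 1)"
        using eventually_ge_at_top[of 1] by eventually_elim (rule bound)
    qed
  qed
qed

lemma limsup_le_zero:
  fixes x y :: "nat \<Rightarrow> real"
  assumes "\<And>K. x K \<le> y K" and "y \<longlonglongrightarrow> 0"
  shows "limsup (\<lambda>K. ereal (x K)) \<le> 0"
proof -
  have "limsup (\<lambda>K. ereal (x K)) \<le> limsup (\<lambda>K. ereal (y K))"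
    using assms(1) by (intro Limsup_mono) simp
  also have "\<dots> = 0"
    using assms(2) by (intro lim_imp_Limsup) (simp_all add: zero_ereal_def)
  finally show ?thesis .
qed

subsection \<open>Frame averages\<close>

lemma avg_add: "avg K (\<lambda>k. x k + y k) = avg K x + avg K y"
  by (simp add: avg_def sum.distrib distrib_left)

lemma avg_diff: "avg K (\<lambda>k. x k - y k) = avg K x - avg K y"
  by (simp add: avg_def sum_subtractf right_diff_distrib)

lemma avg_cmult: "avg K (\<lambda>k. c * x k) = c * avg K x"
  by (simp add: avg_def sum_distrib_left mult.left_commute)

lemma avg_sum: "avg K (\<lambda>k. \<Sum>n\<in>A. x n k) = (\<Sum>n\<in>A. avg K (x n))"
  by (simp add: avg_def sum_distrib_left sum.swap[of _ A])

lemma avg_mono: "(\<And>k. k < K \<Longrightarrow> x k \<le> y k) \<Longrightarrow> avg K x \<le> avg K y"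
  unfolding avg_def by (intro mult_left_mono sum_mono) auto

lemma avg_const: "K \<ge> 1 \<Longrightarrow> avg K (\<lambda>_. c) = c"
  by (simp add: avg_def)

subsection \<open>Measurability along a policy\<close>

text \<open>Nothing is assumed about queues or the choice rule: the facts below are applied both to
  the algorithm and to the policies it is compared with.\<close>

locale task_policy = prob_space P for P :: "'m path measure" +
  fixes S :: "'m task_system"
  assumes system: "task_system S" and policy: "policy S P"
begin

lemma sets_P [measurable_cong]: "sets P = sets (path_space S)"
  using policy by (simp add: policy_def)

lemma space_P: "space P = space (path_space S)"
  using sets_P by (rule sets_eq_imp_space_eq)

lemma frame_measurable [measurable]: "(\<lambda>\<omega>. \<omega> k) \<in> P \<rightarrow>\<^sub>M frame_space S"
  unfolding measurable_cong_sets[OF sets_P refl] path_space_def by simp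

lemma chosen_measurable [measurable]: "chosen k \<in> P \<rightarrow>\<^sub>M choice_space S"
  using frame_measurable[of k] unfolding chosen_def[abs_def] frame_space_def by measurable

lemma outcome_measurable [measurable]: "(\<lambda>\<omega>. snd (\<omega> k)) \<in> P \<rightarrow>\<^sub>M outcome_space S"
  using frame_measurable[of k] unfolding frame_space_def by measurable

lemma space_choice: "space (choice_space S) = choices S"
  by (simp add: choice_space_def choices_def space_pair_measure space_restrict_space)

lemma space_outcome: "space (outcome_space S) = {min_active S..} \<times> UNIV"
  by (simp add: outcome_space_def space_pair_measure space_restrict_space)

lemma chosen_in: "\<omega> \<in> space P \<Longrightarrow> chosen k \<omega> \<in> choices S"
  using measurable_space[OF chosen_measurable] space_choice by blast

lemma chosen_class_in: "\<omega> \<in> space P \<Longrightarrow> chosen_class k \<omega> \<in> classes S"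
  and chosen_mode_in: "\<omega> \<in> space P \<Longrightarrow> chosen_mode k \<omega> \<in> modes S"
  and idle_nonneg: "\<omega> \<in> space P \<Longrightarrow> 0 \<le> idle k \<omega>"
  and idle_le: "\<omega> \<in> space P \<Longrightarrow> idle k \<omega> \<le> max_idle S"
  using chosen_in[of \<omega> k] by (auto simp: choices_def chosen_class_def chosen_mode_def idle_def)

lemma active_ge: "\<omega> \<in> space P \<Longrightarrow> min_active S \<le> active k \<omega>"
  using measurable_space[OF outcome_measurable, of \<omega> k] space_outcome by (auto simp: active_def)

lemma fst_outcome_measurable [measurable]: "fst \<in> borel_measurable (outcome_space S)"
  and snd_outcome_measurable [measurable]: "snd \<in> borel_measurable (outcome_space S)"
proof -
  have "(\<lambda>x. x) \<in> restrict_space borel {min_active S..} \<rightarrow>\<^sub>M (borel :: real measure)"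
    by (rule measurable_restrict_space1) simp
  then show "fst \<in> borel_measurable (outcome_space S)"
    unfolding outcome_space_def by (rule measurable_compose[OF measurable_fst])
  show "snd \<in> borel_measurable (outcome_space S)"
    unfolding outcome_space_def by (rule measurable_snd)
qed

lemma finite_classes: "finite (classes S)"
  by (simp add: classes_def)

lemma finite_modes: "finite (modes S)" and min_active_pos: "0 < min_active S"
  using system by (auto simp: task_system_def)

lemma prob_space_law: "c \<in> classes S \<Longrightarrow> m \<in> modes S \<Longrightarrow> prob_space (outcome_law S c m)"
  and sets_law: "c \<in> classes S \<Longrightarrow> m \<in> modes S \<Longrightarrow> sets (outcome_law S c m) = sets (outcome_space S)"
  using system by (auto simp: task_system_def)

lemma choice_components_measurable:
  "fst \<in> choice_space S \<rightarrow>\<^sub>M count_space (classes S)"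
  "(\<lambda>a. fst (snd a)) \<in> choice_space S \<rightarrow>\<^sub>M count_space (modes S)"
  "(\<lambda>a. snd (snd a)) \<in> borel_measurable (choice_space S)"
proof -
  have "(\<lambda>x. x) \<in> restrict_space borel {0..max_idle S} \<rightarrow>\<^sub>M (borel :: real measure)"
    by (rule measurable_restrict_space1) simp
  then show "(\<lambda>a. snd (snd a)) \<in> borel_measurable (choice_space S)"
    unfolding choice_space_def by (intro measurable_compose[OF measurable_snd] measurable_compose[OF measurable_snd, of _ _ "restrict_space borel {0..max_idle S}"])
qed (simp_all add: choice_space_def)

text \<open>Arbitrary \<open>g\<close> is allowed because classes and modes carry the discrete
  sigma-algebra and there are only countably many classes.\<close>

lemma choice_function_measurable:
  "(\<lambda>a. g (fst a) (fst (snd a))) \<in> choice_space S \<rightarrow>\<^sub>M borel"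
  for g :: "nat \<Rightarrow> 'm \<Rightarrow> real"
proof (rule measurable_compose_countable'[OF _ choice_components_measurable(1)])
  show "(\<lambda>a. g c (fst (snd a))) \<in> choice_space S \<rightarrow>\<^sub>M borel" for c
    by (rule measurable_compose[OF choice_components_measurable(2)]) simp
qed (simp add: classes_def)

section \<open>The sigma-algebra of the past and the current choice\<close>

abbreviation info :: "nat \<Rightarrow> 'm path measure" where
  "info k \<equiv> decision_info S k"

lemma space_info: "space (info k) = space P"
  by (simp add: decision_info_def space_P)

lemma history_measurable_P:
  "(\<lambda>\<omega>. (restrict \<omega> {..<k}, chosen k \<omega>)) \<in> P \<rightarrow>\<^sub>M Pi\<^sub>M {..<k} (\<lambda>_. frame_space S) \<Otimes>\<^sub>M choice_space S"
  by (intro measurable_Pair measurable_restrict) measurable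

lemma history_measurable:
  "(\<lambda>\<omega>. (restrict \<omega> {..<k}, chosen k \<omega>)) \<in> info k \<rightarrow>\<^sub>M Pi\<^sub>M {..<k} (\<lambda>_. frame_space S) \<Otimes>\<^sub>M choice_space S"
  unfolding decision_info_def
  using measurable_space[OF history_measurable_P]
  by (intro measurable_vimage_algebra1) (auto simp: space_P)

lemma subalgebra_info: "subalgebra P (info k)"
  unfolding subalgebra_def space_info
proof
  show "sets (info k) \<subseteq> sets P"
    unfolding decision_info_def space_P[symmetric]
    by (subst sets_vimage_algebra2) (use measurable_space[OF history_measurable_P] measurable_sets[OF history_measurable_P] in auto)
qed simp

sublocale info: finite_measure_subalgebra P "info k" for k
  by unfold_locales (rule subalgebra_info)

lemma chosen_info: "chosen k \<in> info k \<rightarrow>\<^sub>M choice_space S"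
  using measurable_compose[OF history_measurable measurable_snd] by simp

lemma past_info:
  assumes "j < k"
  shows "(\<lambda>\<omega>. \<omega> j) \<in> info k \<rightarrow>\<^sub>M frame_space S"
proof -
  have "(\<lambda>h. fst h j) \<in> Pi\<^sub>M {..<k} (\<lambda>_. frame_space S) \<Otimes>\<^sub>M choice_space S \<rightarrow>\<^sub>M frame_space S"
    by (rule measurable_compose[OF measurable_fst measurable_component_singleton]) (use assms in simp)
  from measurable_compose[OF history_measurable this] show ?thesis
    using assms by simp
qed

text \<open>For \<open>j < k\<close> everything about frame \<open>j\<close> is known when the outcome of frame \<open>k\<close> is drawn, and
  for \<open>j = k\<close> the choice is.\<close>
lemma choice_info: "j \<le> k \<Longrightarrow> chosen j \<in> info k \<rightarrow>\<^sub>M choice_space S"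
proof (cases "j = k")
  case False
  moreover assume "j \<le> k"
  ultimately have "j < k" by simp
  from measurable_compose[OF past_info[OF this, unfolded frame_space_def] measurable_fst]
  show ?thesis by (simp add: chosen_def[abs_def])
qed (simp add: chosen_info)

lemma outcome_info: "j < k \<Longrightarrow> (\<lambda>\<omega>. snd (\<omega> j)) \<in> info k \<rightarrow>\<^sub>M outcome_space S"
  by (rule measurable_compose[OF past_info[unfolded frame_space_def] measurable_snd])

lemma chosen_function_info:
  "j \<le> k \<Longrightarrow> (\<lambda>\<omega>. g (chosen_class j \<omega>) (chosen_mode j \<omega>)) \<in> borel_measurable (info k)"
  for g :: "nat \<Rightarrow> 'm \<Rightarrow> real"
  using measurable_compose[OF choice_info choice_function_measurable[of g]]
  by (simp add: chosen_class_def chosen_mode_def)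

lemma idle_info: "j \<le> k \<Longrightarrow> idle j \<in> borel_measurable (info k)"
  using measurable_compose[OF choice_info choice_components_measurable(3)]
  by (simp add: idle_def[abs_def])

lemma served_info: "j \<le> k \<Longrightarrow> served n j \<in> borel_measurable (info k)"
  using chosen_function_info[of j k "\<lambda>c m. if c = n then 1 else 0"]
  by (simp add: served_def[abs_def])

lemma outcome_function_info:
  "f \<in> borel_measurable (outcome_space S) \<Longrightarrow> j < k \<Longrightarrow> (\<lambda>\<omega>. f (snd (\<omega> j))) \<in> borel_measurable (info k)"
  for f :: "outcome \<Rightarrow> real"
  by (rule measurable_compose[OF outcome_info])

lemma active_info: "j < k \<Longrightarrow> active j \<in> borel_measurable (info k)"
  and energy_info: "j < k \<Longrightarrow> energy j \<in> borel_measurable (info k)"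
  using outcome_function_info[OF fst_outcome_measurable, of j k] outcome_function_info[OF snd_outcome_measurable, of j k]
  by (simp_all add: active_def[abs_def] energy_def[abs_def])

lemma measurable_of_info: "f \<in> borel_measurable (info k) \<Longrightarrow> f \<in> borel_measurable P"
  for f :: "'m path \<Rightarrow> real"
  by (rule measurable_from_subalg[OF subalgebra_info])

lemma active_measurable [measurable]: "active j \<in> borel_measurable P"
  and energy_measurable [measurable]: "energy j \<in> borel_measurable P"
  and idle_measurable [measurable]: "idle j \<in> borel_measurable P"
  and served_measurable [measurable]: "served n j \<in> borel_measurable P"
  using measurable_of_info[OF active_info[OF lessI]] measurable_of_info[OF energy_info[OF lessI]]
    measurable_of_info[OF idle_info[OF order_refl]] measurable_of_info[OF served_info[OF order_refl]]
  by simp_all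

text \<open>The queue of frame \<open>k\<close> is built from earlier frames only, so it can be
  taken out of conditional expectations given \<open>info k\<close>. The induction runs over
  \<open>i\<close> with \<open>k\<close> fixed, since the sigma-algebra must not change along
  it.\<close>

lemma queue_info: "queue rate Q0 n k \<in> borel_measurable (info k)"
proof -
  have "i \<le> k \<Longrightarrow> queue rate Q0 n i \<in> borel_measurable (info k)" for i
  proof (induction i)
    case 0
    then show ?case by (simp add: queue.simps(1)[abs_def])
  next
    case (Suc i)
    then have [measurable]: "queue rate Q0 n i \<in> borel_measurable (info k)"
      "active i \<in> borel_measurable (info k)" "idle i \<in> borel_measurable (info k)"
      "served n i \<in> borel_measurable (info k)"
      using active_info[of i k] idle_info[of i k] served_info[of i k] by auto
    show ?case
      unfolding queue.simps(2)[abs_def] net_arrival_def[abs_def] by measurable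
  qed
  then show ?thesis by simp
qed

lemma net_arrival_measurable [measurable]: "net_arrival rate n k \<in> borel_measurable P"
  unfolding net_arrival_def[abs_def] by measurable

lemma queue_measurable [measurable]: "queue rate Q0 n k \<in> borel_measurable P"
  by (rule measurable_of_info[OF queue_info])

subsection \<open>Outcomes given the past\<close>

text \<open>The candidate for the conditional expectation of \<open>f\<close> applied to the outcome
  of frame \<open>k\<close>; \<open>cond_exp_outcome\<close> identifies the two.\<close>

definition outcome_mean :: "(outcome \<Rightarrow> real) \<Rightarrow> nat \<Rightarrow> 'm path \<Rightarrow> real" where
  "outcome_mean f k \<omega> = (\<integral>x. f x \<partial>outcome_law S (chosen_class k \<omega>) (chosen_mode k \<omega>))"

lemma outcome_mean_info: "j \<le> k \<Longrightarrow> outcome_mean f j \<in> borel_measurable (info k)"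
  using chosen_function_info[of j k "\<lambda>c m. \<integral>x. f x \<partial>outcome_law S c m"]
  by (simp add: outcome_mean_def[abs_def])

lemma outcome_mean_measurable [measurable]: "outcome_mean f k \<in> borel_measurable P"
  using measurable_of_info[OF outcome_mean_info[OF order_refl]] .

text \<open>Only finitely many pairs of class and mode occur, so the conditional means take finitely
  many values. The resulting bound is uniform in the frame.\<close>

lemma outcome_mean_bounded: "\<exists>b. \<forall>k. \<forall>\<omega>\<in>space P. \<bar>outcome_mean f k \<omega>\<bar> \<le> b"
proof -
  define R where "R = (\<lambda>(c, m). \<integral>x. f x \<partial>outcome_law S c m) ` (classes S \<times> modes S)"
  have "finite R"
    unfolding R_def using finite_classes finite_modes by simp
  then obtain b where b: "\<And>y. y \<in> R \<Longrightarrow> \<bar>y\<bar> \<le> b"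
    using finite_imp_bounded[of R] by (auto simp: bounded_iff)
  have "outcome_mean f k \<omega> \<in> R" if "\<omega> \<in> space P" for k \<omega>
    using chosen_class_in[OF that, of k] chosen_mode_in[OF that, of k]
    by (auto simp: outcome_mean_def R_def)
  with b show ?thesis by blast
qed

lemma integrable_mult_bounded:
  fixes f g :: "'m path \<Rightarrow> real"
  assumes "integrable P f" and [measurable]: "g \<in> borel_measurable P"
    and b: "\<And>\<omega>. \<omega> \<in> space P \<Longrightarrow> \<bar>g \<omega>\<bar> \<le> b"
  shows "integrable P (\<lambda>\<omega>. f \<omega> * g \<omega>)"
proof (rule Bochner_Integration.integrable_bound[where f = "\<lambda>\<omega>. b * f \<omega>"])
  show "AE \<omega> in P. norm (f \<omega> * g \<omega>) \<le> norm (b * f \<omega>)"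
  proof (rule AE_I2)
    fix \<omega> assume "\<omega> \<in> space P"
    with b have "\<bar>g \<omega>\<bar> \<le> \<bar>b\<bar>" by force
    then show "norm (f \<omega> * g \<omega>) \<le> norm (b * f \<omega>)"
      by (simp add: abs_mult mult.commute[of "\<bar>b\<bar>"] mult_left_mono)
  qed
qed (use assms in auto)

lemma integrable_mult_outcome_mean:
  "integrable P g \<Longrightarrow> integrable P (\<lambda>\<omega>. g \<omega> * outcome_mean f k \<omega>)"
proof -
  assume g: "integrable P g"
  obtain b where "\<And>\<omega>. \<omega> \<in> space P \<Longrightarrow> \<bar>outcome_mean f k \<omega>\<bar> \<le> b"
    using outcome_mean_bounded[of f] by blast
  from integrable_mult_bounded[OF g outcome_mean_measurable this]
  show "integrable P (\<lambda>\<omega>. g \<omega> * outcome_mean f k \<omega>)" .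
qed

lemma integrable_outcome_mean: "integrable P (outcome_mean f k)"
  using integrable_mult_outcome_mean[of "\<lambda>_. 1"] by simp

text \<open>The defining property of a policy, integrated over \<open>H\<close>: the chosen pair is
  constant there, so the conditional probability is a constant and comes out of the
  integral.\<close>

lemma prob_outcome:
  assumes H: "H \<in> sets (info k)"
    and fixed: "\<And>\<omega>. \<omega> \<in> H \<Longrightarrow> chosen_class k \<omega> = c \<and> chosen_mode k \<omega> = m"
    and A: "A \<in> sets (outcome_space S)"
  shows "prob (H \<inter> ((\<lambda>\<omega>. snd (\<omega> k)) -` A \<inter> space P)) = prob H * measure (outcome_law S c m) A"
proof -
  note [measurable] = A
  have [measurable]: "H \<in> sets P"
    using H subalgebra_info by (auto simp: subalgebra_def)
  let ?E = "(\<lambda>\<omega>. snd (\<omega> k)) -` A \<inter> space P"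
  have E: "?E \<in> sets P" by measurable
  let ?f = "\<lambda>\<omega>. indicator A (active k \<omega>, energy k \<omega>) :: real"
  have eq: "(active k \<omega>, energy k \<omega>) = snd (\<omega> k)" for \<omega> :: "'m path"
    by (simp add: active_def energy_def)
  have [measurable]: "?f \<in> borel_measurable P"
    unfolding eq by measurable
  have int: "integrable P ?f"
    by (rule integrable_const_bound[of _ 1]) (auto split: split_indicator)
  have "prob (H \<inter> ?E) = (\<integral>\<omega>. indicator (H \<inter> ?E) \<omega> \<partial>P)"
    using E by simp
  also have "\<dots> = (\<integral>\<omega>\<in>H. ?f \<omega> \<partial>P)"
    unfolding set_lebesgue_integral_def eq
    by (intro Bochner_Integration.integral_cong) (auto simp: indicator_def)
  also have "\<dots> = (\<integral>\<omega>\<in>H. real_cond_exp P (info k) ?f \<omega> \<partial>P)"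
    by (rule info.real_cond_exp_intA[OF int H])
  also have "\<dots> = (\<integral>\<omega>\<in>H. measure (outcome_law S c m) A \<partial>P)"
    unfolding set_lebesgue_integral_def
  proof (rule integral_cong_AE)
    have "AE \<omega> in P. real_cond_exp P (info k) ?f \<omega>
        = measure (outcome_law S (chosen_class k \<omega>) (chosen_mode k \<omega>)) A"
      using policy A by (simp add: policy_def)
    then show "AE \<omega> in P. indicator H \<omega> *\<^sub>R real_cond_exp P (info k) ?f \<omega>
        = indicator H \<omega> *\<^sub>R measure (outcome_law S c m) A"
      by eventually_elim (use fixed in \<open>auto simp: indicator_def\<close>)
  qed measurable
  also have "\<dots> = prob H * measure (outcome_law S c m) A"
    by (simp add: set_lebesgue_integral_def)
  finally show ?thesis .
qed

text \<open>Lifts the product formula for events to an equality of measures, after which integrals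
  of unbounded functions such as duration and energy follow by change of variables.\<close>

lemma distr_outcome:
  assumes H: "H \<in> sets (info k)"
    and fixed: "\<And>\<omega>. \<omega> \<in> H \<Longrightarrow> chosen_class k \<omega> = c \<and> chosen_mode k \<omega> = m"
    and c: "c \<in> classes S" and m: "m \<in> modes S"
  shows "distr (density P (\<lambda>\<omega>. ennreal (indicator H \<omega>))) (outcome_space S) (\<lambda>\<omega>. snd (\<omega> k))
    = density (outcome_law S c m) (\<lambda>_. ennreal (prob H))"
proof (rule measure_eqI)
  show "sets (distr (density P (\<lambda>\<omega>. ennreal (indicator H \<omega>))) (outcome_space S) (\<lambda>\<omega>. snd (\<omega> k)))
    = sets (density (outcome_law S c m) (\<lambda>_. ennreal (prob H)))"
    using sets_law[OF c m] by simp
  interpret L: prob_space "outcome_law S c m" using prob_space_law[OF c m] .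
  fix A assume "A \<in> sets (distr (density P (\<lambda>\<omega>. ennreal (indicator H \<omega>))) (outcome_space S) (\<lambda>\<omega>. snd (\<omega> k)))"
  then have A [measurable]: "A \<in> sets (outcome_space S)" by simp
  have AL: "A \<in> sets (outcome_law S c m)" using A sets_law[OF c m] by simp
  have [measurable]: "H \<in> sets P"
    using H subalgebra_info by (auto simp: subalgebra_def)
  let ?E = "(\<lambda>\<omega>. snd (\<omega> k)) -` A \<inter> space P"
  have E [measurable]: "?E \<in> sets P" by measurable
  have "emeasure (distr (density P (\<lambda>\<omega>. ennreal (indicator H \<omega>))) (outcome_space S) (\<lambda>\<omega>. snd (\<omega> k))) A
      = emeasure (density P (\<lambda>\<omega>. ennreal (indicator H \<omega>))) ?E"
    by (subst emeasure_distr) auto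
  also have "\<dots> = (\<integral>\<^sup>+\<omega>. ennreal (indicator H \<omega>) * indicator ?E \<omega> \<partial>P)"
    by (rule emeasure_density) auto
  also have "\<dots> = (\<integral>\<^sup>+\<omega>. indicator (H \<inter> ?E) \<omega> \<partial>P)"
    by (intro nn_integral_cong) (auto simp: indicator_def)
  also have "\<dots> = ennreal (prob (H \<inter> ?E))"
    by (simp add: emeasure_eq_measure)
  also have "\<dots> = ennreal (prob H) * emeasure (outcome_law S c m) A"
    by (simp add: prob_outcome[OF H fixed A] L.emeasure_eq_measure ennreal_mult')
  also have "\<dots> = emeasure (density (outcome_law S c m) (\<lambda>_. ennreal (prob H))) A"
    by (rule emeasure_density_const[symmetric, OF AL])
  finally show "emeasure (distr (density P (\<lambda>\<omega>. ennreal (indicator H \<omega>))) (outcome_space S) (\<lambda>\<omega>. snd (\<omega> k))) A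
    = emeasure (density (outcome_law S c m) (\<lambda>_. ennreal (prob H))) A" .
qed

lemma set_integral_outcome:
  fixes f :: "outcome \<Rightarrow> real"
  assumes H: "H \<in> sets (info k)"
    and fixed: "\<And>\<omega>. \<omega> \<in> H \<Longrightarrow> chosen_class k \<omega> = c \<and> chosen_mode k \<omega> = m"
    and c: "c \<in> classes S" and m: "m \<in> modes S"
    and f [measurable]: "f \<in> borel_measurable (outcome_space S)"
  shows "(\<integral>\<omega>\<in>H. f (snd (\<omega> k)) \<partial>P) = prob H * (\<integral>x. f x \<partial>outcome_law S c m)"
proof -
  have [measurable]: "H \<in> sets P"
    using H subalgebra_info by (auto simp: subalgebra_def)
  have fL: "f \<in> borel_measurable (outcome_law S c m)"
    using f measurable_cong_sets[OF sets_law[OF c m] refl] by blast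
  have "(\<integral>\<omega>\<in>H. f (snd (\<omega> k)) \<partial>P)
      = (\<integral>\<omega>. f (snd (\<omega> k)) \<partial>density P (\<lambda>\<omega>. ennreal (indicator H \<omega>)))"
    unfolding set_lebesgue_integral_def by (subst integral_density) auto
  also have "\<dots> = (\<integral>x. f x \<partial>distr (density P (\<lambda>\<omega>. ennreal (indicator H \<omega>))) (outcome_space S) (\<lambda>\<omega>. snd (\<omega> k)))"
    by (subst integral_distr) auto
  also have "\<dots> = prob H * (\<integral>x. f x \<partial>outcome_law S c m)"
    by (subst distr_outcome[OF H fixed c m], assumption, subst integral_density) (use fL in auto)
  finally show ?thesis .
qed

lemma choice_fiber_info: "{\<omega> \<in> space P. chosen_class k \<omega> = c \<and> chosen_mode k \<omega> = m} \<in> sets (info k)"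
proof -
  have "(\<lambda>\<omega>. if chosen_class k \<omega> = c \<and> chosen_mode k \<omega> = m then 1 else 0 :: real) \<in> borel_measurable (info k)"
    by (rule chosen_function_info[OF order_refl, of "\<lambda>x y. if x = c \<and> y = m then 1 else 0"])
  from measurable_sets[OF this, of "{1}"] show ?thesis
    unfolding space_info by (rule back_subst[where P = "\<lambda>A. A \<in> _"]) (auto split: if_splits)
qed

text \<open>A policy prescribes conditional probabilities of sets only. To pass to integrable
  functions, an event of \<open>info k\<close> is cut into the finitely many pieces on which the
  chosen pair is constant, and on each piece the integral is given by the outcome law.\<close>

lemma cond_exp_outcome:
  assumes f: "f \<in> borel_measurable (outcome_space S)"
    and int: "integrable P (\<lambda>\<omega>. f (snd (\<omega> k)))"
  shows "AE \<omega> in P. real_cond_exp P (info k) (\<lambda>\<omega>. f (snd (\<omega> k))) \<omega> = outcome_mean f k \<omega>"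
proof (rule info.real_cond_exp_charact[OF _ int integrable_outcome_mean outcome_mean_info[OF order_refl]])
  fix A assume A: "A \<in> sets (info k)"
  let ?I = "classes S \<times> modes S"
  define H where "H = (\<lambda>(c, m). A \<inter> {\<omega> \<in> space P. chosen_class k \<omega> = c \<and> chosen_mode k \<omega> = m})"
  have H: "H p \<in> sets (info k)" for p
    using A choice_fiber_info by (auto simp: H_def split: prod.split)
  then have HP [measurable]: "H p \<in> sets P" for p
    using subalgebra_info[of k] unfolding subalgebra_def by blast
  have "A \<subseteq> space P"
    using sets.sets_into_space[OF A] space_info by simp
  then have union: "A = (\<Union>p\<in>?I. H p)"
    using chosen_class_in[of _ k] chosen_mode_in[of _ k] unfolding H_def by fastforce
  have disj: "disjoint_family_on H ?I"
    by (auto simp: disjoint_family_on_def H_def)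
  have fin: "finite ?I" using finite_classes finite_modes by simp
  have split: "(\<integral>\<omega>\<in>A. g \<omega> \<partial>P) = (\<Sum>p\<in>?I. \<integral>\<omega>\<in>H p. g \<omega> \<partial>P)" if "integrable P g" for g :: "'m path \<Rightarrow> real"
    unfolding union
    by (rule set_integral_finite_Union[OF fin disj])
      (use that in \<open>auto simp: set_integrable_def intro!: integrable_mult_indicator simp del: real_scaleR_def\<close>)
  have "(\<integral>\<omega>\<in>H p. f (snd (\<omega> k)) \<partial>P) = (\<integral>\<omega>\<in>H p. outcome_mean f k \<omega> \<partial>P)" if p_in: "p \<in> ?I" for p
  proof -
    obtain c m where p: "p = (c, m)" and c: "c \<in> classes S" and m: "m \<in> modes S"
      using p_in by auto
    have fixed: "chosen_class k \<omega> = c \<and> chosen_mode k \<omega> = m" if "\<omega> \<in> H p" for \<omega>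
      using that by (auto simp: H_def p)
    have "(\<integral>\<omega>\<in>H p. outcome_mean f k \<omega> \<partial>P) = (\<integral>\<omega>\<in>H p. (\<integral>x. f x \<partial>outcome_law S c m) \<partial>P)"
      unfolding set_lebesgue_integral_def
      by (intro Bochner_Integration.integral_cong) (auto simp: indicator_def outcome_mean_def dest: fixed)
    also have "\<dots> = prob (H p) * (\<integral>x. f x \<partial>outcome_law S c m)"
      by (simp add: set_lebesgue_integral_def)
    finally show ?thesis
      using set_integral_outcome[OF H fixed c m f] by simp
  qed
  then show "(\<integral>\<omega>\<in>A. f (snd (\<omega> k)) \<partial>P) = (\<integral>\<omega>\<in>A. outcome_mean f k \<omega> \<partial>P)"
    unfolding split[OF int] split[OF integrable_outcome_mean] by (rule sum.cong[OF refl])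
qed

text \<open>A factor known before the outcome of frame \<open>k\<close> is drawn may be moved inside
  the conditional expectation, which is then replaced by \<open>outcome_mean\<close>.\<close>

lemma expectation_mult_outcome:
  assumes g: "g \<in> borel_measurable (info k)" and f: "f \<in> borel_measurable (outcome_space S)"
    and int: "integrable P (\<lambda>\<omega>. f (snd (\<omega> k)))" "integrable P (\<lambda>\<omega>. g \<omega> * f (snd (\<omega> k)))"
  shows "(\<integral>\<omega>. g \<omega> * f (snd (\<omega> k)) \<partial>P) = (\<integral>\<omega>. g \<omega> * outcome_mean f k \<omega> \<partial>P)"
proof -
  have [measurable]: "g \<in> borel_measurable P" by (rule measurable_of_info[OF g])
  have [measurable]: "(\<lambda>\<omega>. f (snd (\<omega> k))) \<in> borel_measurable P" using int(1) by simp
  have "(\<integral>\<omega>. g \<omega> * f (snd (\<omega> k)) \<partial>P)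
      = (\<integral>\<omega>. g \<omega> * real_cond_exp P (info k) (\<lambda>\<omega>. f (snd (\<omega> k))) \<omega> \<partial>P)"
    using info.real_cond_exp_intg(2)[OF int(2) g] by simp
  also have "\<dots> = (\<integral>\<omega>. g \<omega> * outcome_mean f k \<omega> \<partial>P)"
    by (rule integral_cong_AE) (use cond_exp_outcome[OF f int(1)] in auto)
  finally show ?thesis .
qed

text \<open>The deviations from the conditional means are orthogonal martingale differences, so
  their second moments add up. Each is at most the second moment of \<open>f\<close>, because
  centring at the conditional mean only reduces it.\<close>

lemma fluctuation_second_moment:
  fixes f :: "outcome \<Rightarrow> real"
  assumes f [measurable]: "f \<in> borel_measurable (outcome_space S)"
    and sq: "\<And>k. integrable P (\<lambda>\<omega>. (f (snd (\<omega> k)))\<^sup>2)"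
    and le: "\<And>k. (\<integral>\<omega>. (f (snd (\<omega> k)))\<^sup>2 \<partial>P) \<le> C"
  shows "integrable P (\<lambda>\<omega>. (\<Sum>k<K. f (snd (\<omega> k)) - outcome_mean f k \<omega>)\<^sup>2)" (is "integrable P (\<lambda>\<omega>. (?M K \<omega>)\<^sup>2)")
    and "(\<integral>\<omega>. (\<Sum>k<K. f (snd (\<omega> k)) - outcome_mean f k \<omega>)\<^sup>2 \<partial>P) \<le> real K * C"
proof -
  let ?F = "\<lambda>k \<omega>. f (snd (\<omega> k))"
  have [measurable]: "?F k \<in> borel_measurable P" for k by measurable
  have int: "integrable P (?F k)" for k
    by (rule square_integrable_imp_integrable[OF _ sq]) measurable
  have mean_sq: "integrable P (\<lambda>\<omega>. (outcome_mean f k \<omega>)\<^sup>2)" for k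
    unfolding power2_eq_square by (intro integrable_mult_outcome_mean integrable_outcome_mean)
  define d where "d k \<omega> = ?F k \<omega> - outcome_mean f k \<omega>" for k \<omega>
  have [measurable]: "d k \<in> borel_measurable P" for k unfolding d_def by measurable
  have d_sq: "integrable P (\<lambda>\<omega>. (d k \<omega>)\<^sup>2)"
    and d_le: "(\<integral>\<omega>. (d k \<omega>)\<^sup>2 \<partial>P) \<le> C" for k
  proof -
    have cross: "integrable P (\<lambda>\<omega>. outcome_mean f k \<omega> * ?F k \<omega>)"
      by (rule integrable_mult_of_squares) (use sq mean_sq in auto)
    have expand: "(d k \<omega>)\<^sup>2 = (?F k \<omega>)\<^sup>2 - 2 * (outcome_mean f k \<omega> * ?F k \<omega>) + (outcome_mean f k \<omega>)\<^sup>2" for \<omega>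
      unfolding d_def by (simp add: power2_diff)
    show "integrable P (\<lambda>\<omega>. (d k \<omega>)\<^sup>2)"
      unfolding expand using cross sq mean_sq by simp
    have "(\<integral>\<omega>. (d k \<omega>)\<^sup>2 \<partial>P) = (\<integral>\<omega>. (?F k \<omega>)\<^sup>2 \<partial>P) - 2 * (\<integral>\<omega>. outcome_mean f k \<omega> * ?F k \<omega> \<partial>P)
        + (\<integral>\<omega>. (outcome_mean f k \<omega>)\<^sup>2 \<partial>P)"
      unfolding expand using cross sq mean_sq by simp
    \<comment> \<open>By conditioning, the cross term equals the second moment of the conditional
      mean, so one of the two copies subtracted cancels the added one.\<close>
    also have "\<dots> = (\<integral>\<omega>. (?F k \<omega>)\<^sup>2 \<partial>P) - (\<integral>\<omega>. (outcome_mean f k \<omega>)\<^sup>2 \<partial>P)"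
      using expectation_mult_outcome[OF outcome_mean_info[OF order_refl] f int cross]
      by (simp add: power2_eq_square)
    also have "\<dots> \<le> C"
    proof -
      have "0 \<le> (\<integral>\<omega>. (outcome_mean f k \<omega>)\<^sup>2 \<partial>P)" by simp
      then show ?thesis using le[of k] by linarith
    qed
    finally show "(\<integral>\<omega>. (d k \<omega>)\<^sup>2 \<partial>P) \<le> C" .
  qed
  \<comment> \<open>The sum stops before frame \<open>K\<close>, so it is known when that frame's
    outcome is drawn; this is what makes the next deviation orthogonal to it.\<close>
  have M_info: "?M K \<in> borel_measurable (info K)" for K
    by (intro borel_measurable_sum borel_measurable_diff outcome_function_info[OF f] outcome_mean_info) auto
  have [measurable]: "?M K \<in> borel_measurable P" for K
    by (rule measurable_of_info[OF M_info])
  have "integrable P (\<lambda>\<omega>. (?M K \<omega>)\<^sup>2) \<and> (\<integral>\<omega>. (?M K \<omega>)\<^sup>2 \<partial>P) \<le> real K * C"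
  proof (induction K)
    case (Suc K)
    then have M_sq: "integrable P (\<lambda>\<omega>. (?M K \<omega>)\<^sup>2)" by simp
    have MF: "integrable P (\<lambda>\<omega>. ?M K \<omega> * ?F K \<omega>)"
      by (rule integrable_mult_of_squares[OF _ _ M_sq sq]) measurable
    have Md: "integrable P (\<lambda>\<omega>. ?M K \<omega> * d K \<omega>)"
      by (rule integrable_mult_of_squares[OF _ _ M_sq d_sq]) measurable
    have Mm: "integrable P (\<lambda>\<omega>. ?M K \<omega> * outcome_mean f K \<omega>)"
      by (rule integrable_mult_of_squares[OF _ _ M_sq mean_sq]) measurable
    have "(\<integral>\<omega>. ?M K \<omega> * d K \<omega> \<partial>P) = (\<integral>\<omega>. ?M K \<omega> * ?F K \<omega> \<partial>P) - (\<integral>\<omega>. ?M K \<omega> * outcome_mean f K \<omega> \<partial>P)"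
      unfolding d_def right_diff_distrib using MF Mm by (rule Bochner_Integration.integral_diff)
    also have "\<dots> = 0"
      using expectation_mult_outcome[OF M_info f int MF] by simp
    finally have orth: "(\<integral>\<omega>. ?M K \<omega> * d K \<omega> \<partial>P) = 0" .
    have expand: "(?M (Suc K) \<omega>)\<^sup>2 = (?M K \<omega>)\<^sup>2 + 2 * (?M K \<omega> * d K \<omega>) + (d K \<omega>)\<^sup>2" for \<omega>
      by (simp add: d_def power2_sum)
    have "(\<integral>\<omega>. (?M (Suc K) \<omega>)\<^sup>2 \<partial>P)
        = (\<integral>\<omega>. (?M K \<omega>)\<^sup>2 \<partial>P) + 2 * (\<integral>\<omega>. ?M K \<omega> * d K \<omega> \<partial>P) + (\<integral>\<omega>. (d K \<omega>)\<^sup>2 \<partial>P)"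
      unfolding expand using M_sq Md d_sq by simp
    also have "\<dots> \<le> real (Suc K) * C"
      using Suc d_le[of K] orth by (simp add: algebra_simps)
    finally show ?case
      unfolding expand using M_sq Md d_sq by simp
  qed simp
  then show "integrable P (\<lambda>\<omega>. (?M K \<omega>)\<^sup>2)" "(\<integral>\<omega>. (?M K \<omega>)\<^sup>2 \<partial>P) \<le> real K * C"
    by auto
qed

lemma fluctuation_tendsto_zero:
  fixes f :: "outcome \<Rightarrow> real"
  assumes f [measurable]: "f \<in> borel_measurable (outcome_space S)"
    and sq: "\<And>k. integrable P (\<lambda>\<omega>. (f (snd (\<omega> k)))\<^sup>2)"
    and le: "\<And>k. (\<integral>\<omega>. (f (snd (\<omega> k)))\<^sup>2 \<partial>P) \<le> C"
  shows "AE \<omega> in P. (\<lambda>j. avg ((j + 1)\<^sup>2) (\<lambda>k. f (snd (\<omega> k)) - outcome_mean f k \<omega>)) \<longlonglongrightarrow> 0"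
proof -
  note moment = fluctuation_second_moment[OF f sq le]
  have "(\<lambda>\<omega>. \<Sum>k<K. f (snd (\<omega> k)) - outcome_mean f k \<omega>) \<in> borel_measurable P" for K
    by measurable
  from AE_square_subsequence[OF this moment] show ?thesis
    by (simp add: avg_def)
qed

subsection \<open>Comparison with an arbitrary admissible policy\<close>

lemma active_square_integrable: "integrable P (\<lambda>\<omega>. (active k \<omega>)\<^sup>2)"
  and active_square_le: "(\<integral>\<omega>. (active k \<omega>)\<^sup>2 \<partial>P) \<le> moment_bound S"
  and energy_square_integrable: "integrable P (\<lambda>\<omega>. (energy k \<omega>)\<^sup>2)"
  and energy_square_le: "(\<integral>\<omega>. (energy k \<omega>)\<^sup>2 \<partial>P) \<le> moment_bound S"
  using system policy by (auto simp: task_system_def)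

lemma active_integrable: "integrable P (active k)"
  and energy_integrable: "integrable P (energy k)"
  by (rule square_integrable_imp_integrable[OF active_measurable active_square_integrable],
      rule square_integrable_imp_integrable[OF energy_measurable energy_square_integrable])

lemma idle_square_integrable: "integrable P (\<lambda>\<omega>. (idle k \<omega>)\<^sup>2)"
proof (rule integrable_const_bound[of _ "(max_idle S)\<^sup>2"])
  show "AE \<omega> in P. norm ((idle k \<omega>)\<^sup>2) \<le> (max_idle S)\<^sup>2"
    by (rule AE_I2) (simp add: idle_le idle_nonneg power_mono)
qed measurable

lemma idle_integrable: "integrable P (idle k)"
  by (rule square_integrable_imp_integrable[OF idle_measurable idle_square_integrable])

lemma served_square_integrable: "integrable P (\<lambda>\<omega>. (served n k \<omega>)\<^sup>2)"
proof (rule integrable_const_bound[of _ 1])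
  show "AE \<omega> in P. norm ((served n k \<omega>)\<^sup>2) \<le> 1"
    by (simp add: served_def)
qed measurable

lemma served_integrable: "integrable P (served n k)"
  by (rule square_integrable_imp_integrable[OF served_measurable served_square_integrable])

section \<open>Conditional mean durations and energies\<close>

lemma active_as_outcome: "active k = (\<lambda>\<omega>. fst (snd (\<omega> k)))"
  and energy_as_outcome: "energy k = (\<lambda>\<omega>. snd (snd (\<omega> k)))"
  by (simp_all add: active_def[abs_def] energy_def[abs_def])

abbreviation cond_active :: "nat \<Rightarrow> 'm path \<Rightarrow> real" where
  "cond_active \<equiv> outcome_mean fst"

abbreviation cond_energy :: "nat \<Rightarrow> 'm path \<Rightarrow> real" where
  "cond_energy \<equiv> outcome_mean snd"

lemma cond_active_eq: "mean_active S (chosen_class k \<omega>) (chosen_mode k \<omega>) = cond_active k \<omega>"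
  and cond_energy_eq: "mean_energy S (chosen_class k \<omega>) (chosen_mode k \<omega>) = cond_energy k \<omega>"
  by (simp_all add: mean_active_def mean_energy_def outcome_mean_def)

text \<open>The bound is inherited from the conditional expectation of \<open>active k\<close>,
  whose integrability under \<open>P\<close> is at hand; it is therefore an almost sure one.\<close>

lemma cond_active_ge: "AE \<omega> in P. \<forall>k. min_active S \<le> cond_active k \<omega>"
  unfolding AE_all_countable
proof
  fix k
  have "AE \<omega> in P. min_active S \<le> real_cond_exp P (info k) (active k) \<omega>"
    using active_ge by (intro info.real_cond_exp_ge_c active_integrable) auto
  moreover have "AE \<omega> in P. real_cond_exp P (info k) (active k) \<omega> = cond_active k \<omega>"
    using cond_exp_outcome[OF fst_outcome_measurable] active_integrable
    unfolding active_as_outcome by blast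
  ultimately show "AE \<omega> in P. min_active S \<le> cond_active k \<omega>"
    by eventually_elim simp
qed

lemma scheduling_index_chosen:
  "scheduling_index S V q (chosen k \<omega>)
    = (V * cond_energy k \<omega> - q (chosen_class k \<omega>)) / (cond_active k \<omega> + idle k \<omega>)"
  unfolding cond_active_eq[symmetric] cond_energy_eq[symmetric]
  by (simp add: scheduling_index_def chosen_class_def chosen_mode_def idle_def split_beta)

text \<open>Makes the numerator of the index linear in the indicators \<open>served n k\<close>, so
  that it can be averaged over frames and compared with the rates.\<close>

lemma queue_of_chosen_class:
  "\<omega> \<in> space P \<Longrightarrow> q (chosen_class k \<omega>) = (\<Sum>n\<in>classes S. q n * served n k \<omega>)"
  using chosen_class_in[of \<omega> k] finite_classes
  by (simp add: served_def if_distrib[where f = "\<lambda>y. _ * y"] cong: if_cong)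

text \<open>The index is at least \<open>\<theta>\<close> on every frame; averaging this along one typical path and letting
  the conditional means be replaced by the actual outcomes gives the bound for the frame averages.\<close>
lemma index_bound_frame_average:
  assumes \<theta>: "\<And>a. a \<in> choices S \<Longrightarrow> \<theta> \<le> scheduling_index S V q a"
    and e: "has_frame_average P energy e" and D: "has_frame_average P active D"
    and I: "has_frame_average P idle I"
    and s: "\<And>n. n \<in> classes S \<Longrightarrow> has_frame_average P (served n) (s n)"
  shows "\<theta> * (D + I) \<le> V * e - (\<Sum>n\<in>classes S. q n * s n)" and "min_active S \<le> D + I"
proof -
  let ?r = "\<lambda>j::nat. (j + 1)\<^sup>2"
  have "AE \<omega> in P. (\<lambda>j. avg (?r j) (\<lambda>k. active k \<omega> - cond_active k \<omega>)) \<longlonglongrightarrow> 0"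
    using fluctuation_tendsto_zero[OF fst_outcome_measurable] active_square_integrable active_square_le
    unfolding active_as_outcome by blast
  moreover have "AE \<omega> in P. (\<lambda>j. avg (?r j) (\<lambda>k. energy k \<omega> - cond_energy k \<omega>)) \<longlonglongrightarrow> 0"
    using fluctuation_tendsto_zero[OF snd_outcome_measurable] energy_square_integrable energy_square_le
    unfolding energy_as_outcome by blast
  moreover have "AE \<omega> in P. \<forall>n\<in>classes S. (\<lambda>K. avg K (\<lambda>k. served n k \<omega>)) \<longlonglongrightarrow> s n"
    using s finite_classes by (intro AE_finite_allI) (auto simp: has_frame_average_def)
  moreover note e[unfolded has_frame_average_def] D[unfolded has_frame_average_def]
    I[unfolded has_frame_average_def] cond_active_ge AE_space
  ultimately have "AE \<omega> in P. \<theta> * (D + I) \<le> V * e - (\<Sum>n\<in>classes S. q n * s n) \<and> min_active S \<le> D + I"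
  proof eventually_elim
    case (elim \<omega>)
    \<comment> \<open>The deviations are known to vanish only along the squares, so the assumed
      limits are restricted to the same subsequence. There the conditional means have the same
      limits \<open>D\<close> and \<open>e\<close> as the actual outcomes.\<close>
    have sub: "strict_mono ?r"
      by (rule strict_monoI) (simp add: power_strict_mono)
    note along = LIMSEQ_subseq_LIMSEQ[OF _ sub, unfolded comp_def]
    have "(\<lambda>j. avg (?r j) (\<lambda>k. cond_active k \<omega>)) \<longlonglongrightarrow> D"
      using tendsto_diff[OF along[OF elim(5)] elim(1)] by (simp add: avg_diff)
    moreover have "(\<lambda>j. avg (?r j) (\<lambda>k. cond_energy k \<omega>)) \<longlonglongrightarrow> e"
      using tendsto_diff[OF along[OF elim(4)] elim(2)] by (simp add: avg_diff)
    moreover have served_lim: "(\<lambda>j. avg (?r j) (\<lambda>k. served n k \<omega>)) \<longlonglongrightarrow> s n" if "n \<in> classes S" for n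
      by (rule along) (use elim(3) that in blast)
    ultimately have lim: "(\<lambda>j. V * avg (?r j) (\<lambda>k. cond_energy k \<omega>)
        - (\<Sum>n\<in>classes S. q n * avg (?r j) (\<lambda>k. served n k \<omega>))
        - \<theta> * (avg (?r j) (\<lambda>k. cond_active k \<omega>) + avg (?r j) (\<lambda>k. idle k \<omega>)))
      \<longlonglongrightarrow> V * e - (\<Sum>n\<in>classes S. q n * s n) - \<theta> * (D + I)"
      by (intro tendsto_intros along[OF elim(6)] served_lim)
    \<comment> \<open>Multiplying by the positive frame size clears the denominator. The inequality
      becomes linear in the quantities of the frame and hence survives averaging, which the ratio
      itself would not.\<close>
    have frame: "0 \<le> V * cond_energy k \<omega> - (\<Sum>n\<in>classes S. q n * served n k \<omega>)
        - \<theta> * (cond_active k \<omega> + idle k \<omega>)" for k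
    proof -
      have "0 < cond_active k \<omega> + idle k \<omega>"
        using elim(7) idle_nonneg[OF elim(8), of k] min_active_pos by (smt (verit))
      moreover have "\<theta> \<le> (V * cond_energy k \<omega> - q (chosen_class k \<omega>)) / (cond_active k \<omega> + idle k \<omega>)"
        using \<theta>[OF chosen_in[OF elim(8)], of k] unfolding scheduling_index_chosen .
      ultimately show ?thesis
        unfolding queue_of_chosen_class[OF elim(8)] by (simp add: pos_le_divide_eq)
    qed
    have "0 \<le> V * avg K (\<lambda>k. cond_energy k \<omega>)
        - (\<Sum>n\<in>classes S. q n * avg K (\<lambda>k. served n k \<omega>))
        - \<theta> * (avg K (\<lambda>k. cond_active k \<omega>) + avg K (\<lambda>k. idle k \<omega>))" for K
    proof -
      have "avg K (\<lambda>_. 0) \<le> avg K (\<lambda>k. V * cond_energy k \<omega> - (\<Sum>n\<in>classes S. q n * served n k \<omega>)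
        - \<theta> * (cond_active k \<omega> + idle k \<omega>))"
        by (rule avg_mono) (rule frame)
      then show ?thesis
        by (simp only: avg_diff avg_add avg_cmult avg_sum) (simp add: avg_def)
    qed
    then have "0 \<le> V * e - (\<Sum>n\<in>classes S. q n * s n) - \<theta> * (D + I)"
      by (intro LIMSEQ_le_const[OF lim]) auto
    moreover have "min_active S \<le> D + I"
    proof (rule LIMSEQ_le_const[OF tendsto_add[OF elim(5,6)]])
      have "min_active S \<le> avg K (\<lambda>k. active k \<omega>) + avg K (\<lambda>k. idle k \<omega>)" if "K \<ge> 1" for K
      proof -
        have "avg K (\<lambda>_. min_active S) \<le> avg K (\<lambda>k. active k \<omega> + idle k \<omega>)"
          by (rule avg_mono) (use active_ge[OF elim(8)] idle_nonneg[OF elim(8)] in \<open>simp add: add_increasing2\<close>)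
        then show ?thesis using that by (simp add: avg_const avg_add)
      qed
      then show "\<exists>N. \<forall>K\<ge>N. min_active S \<le> avg K (\<lambda>k. active k \<omega>) + avg K (\<lambda>k. idle k \<omega>)"
        by blast
    qed
    ultimately show ?case by simp
  qed
  \<comment> \<open>The statement does not depend on \<omega>, so holding almost surely under a
    probability measure means holding outright.\<close>
  then show "\<theta> * (D + I) \<le> V * e - (\<Sum>n\<in>classes S. q n * s n)" and "min_active S \<le> D + I"
    by simp_all
qed

end

text \<open>Dividing the frame average bound by \<open>D + I\<close> turns \<open>e\<close> into the
  power \<open>p\<close>, and the constraint replaces \<open>s n / (D + I)\<close> by
  \<open>rate n\<close>; nonnegative weights \<open>q n\<close> keep the direction. The vector
  \<open>q\<close> is fixed and unrelated to the comparison policy, so any observed queue vector can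
  be inserted later.\<close>

lemma index_bound_attainable:
  assumes sys: "task_system S" and p: "p \<in> attainable_powers S rate"
    and q: "\<And>n. n \<in> classes S \<Longrightarrow> 0 \<le> q n"
    and \<theta>: "\<And>a. a \<in> choices S \<Longrightarrow> \<theta> \<le> scheduling_index S V q a"
  shows "\<theta> \<le> V * p - (\<Sum>n\<in>classes S. q n * rate n)"
proof -
  obtain e D I P s where p_eq: "p = e / (D + I)" and pol: "policy S P"
    and avgs: "has_frame_average P energy e" "has_frame_average P active D" "has_frame_average P idle I"
    and served: "\<forall>n\<in>classes S. has_frame_average P (served n) (s n) \<and> rate n \<le> s n / (D + I)"
    using p unfolding attainable_powers_def by blast
  interpret task_policy P S
    using sys pol by (simp add: task_policy_def task_policy_axioms_def policy_def)
  note bound = index_bound_frame_average[OF \<theta> avgs, of s]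
  have pos: "0 < D + I"
    using bound(2) served min_active_pos by fastforce
  have "(\<Sum>n\<in>classes S. q n * rate n) \<le> (\<Sum>n\<in>classes S. q n * (s n / (D + I)))"
    using served by (intro sum_mono mult_left_mono q) auto
  also have "\<dots> = (\<Sum>n\<in>classes S. q n * s n) / (D + I)"
    by (simp add: sum_divide_distrib)
  finally have "(\<Sum>n\<in>classes S. q n * rate n) \<le> (\<Sum>n\<in>classes S. q n * s n) / (D + I)" .
  moreover have "\<theta> \<le> (V * e - (\<Sum>n\<in>classes S. q n * s n)) / (D + I)"
    using bound(1) served pos by (simp add: pos_le_divide_eq)
  ultimately show ?thesis
    by (simp add: p_eq diff_divide_distrib)
qed

text \<open>For positive \<open>V\<close> the previous bound says that every attainable power is at
  least a fixed number, so the infimum is too. For \<open>V = 0\<close> that division is impossible,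
  but the power term vanishes and a single attainable power gives the claim.\<close>

lemma index_bound_power_opt:
  assumes sys: "task_system S" and feas: "feasible S rate" and V: "0 \<le> V"
    and q: "\<And>n. n \<in> classes S \<Longrightarrow> 0 \<le> q n"
    and \<theta>: "\<And>a. a \<in> choices S \<Longrightarrow> \<theta> \<le> scheduling_index S V q a"
  shows "\<theta> \<le> V * power_opt S rate - (\<Sum>n\<in>classes S. q n * rate n)"
proof -
  have nonempty: "attainable_powers S rate \<noteq> {}"
    using feas by (simp add: feasible_def)
  note bound = index_bound_attainable[OF sys _ q \<theta>]
  show ?thesis
  proof (cases "V = 0")
    case True
    then show ?thesis using nonempty bound by fastforce
  next
    case False
    then have "0 < V" using V by simp
    have "(\<theta> + (\<Sum>n\<in>classes S. q n * rate n)) / V \<le> power_opt S rate"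
      unfolding power_opt_def
    proof (rule cInf_greatest[OF nonempty])
      fix p assume "p \<in> attainable_powers S rate"
      from bound[OF this] \<open>0 < V\<close>
      show "(\<theta> + (\<Sum>n\<in>classes S. q n * rate n)) / V \<le> p"
        by (simp add: pos_divide_le_eq mult.commute)
    qed
    with \<open>0 < V\<close> show ?thesis by (simp add: pos_divide_le_eq mult.commute)
  qed
qed

subsection \<open>Drift of the scheduling algorithm\<close>

locale scheduling = task_policy P S for P :: "'m path measure" and S :: "'m task_system" +
  fixes rate Q0 :: "nat \<Rightarrow> real" and V B :: real
  assumes Q0_zero: "\<And>n. n \<in> classes S \<Longrightarrow> Q0 n = 0"
    and feas: "feasible S rate"
    and drift: "drift_bound S rate Q0 B"
    and V_nonneg: "0 \<le> V"
    and algorithm: "AE \<omega> in P. \<forall>k. is_arg_min (scheduling_index S V (\<lambda>n. queue rate Q0 n k \<omega>))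
        (\<lambda>a. a \<in> choices S) (chosen k \<omega>)"
begin

abbreviation p_opt :: real where "p_opt \<equiv> power_opt S rate"

abbreviation Q :: "nat \<Rightarrow> nat \<Rightarrow> 'm path \<Rightarrow> real" where "Q \<equiv> queue rate Q0"

abbreviation X :: "nat \<Rightarrow> nat \<Rightarrow> 'm path \<Rightarrow> real" where "X \<equiv> net_arrival rate"

section \<open>Integrability of queues and net arrivals\<close>

lemma queue_nonneg: "n \<in> classes S \<Longrightarrow> 0 \<le> Q n k \<omega>"
  by (cases k) (simp_all add: Q0_zero)

lemma net_square_integrable: "integrable P (\<lambda>\<omega>. (X n k \<omega>)\<^sup>2)"
proof -
  have sum_sq: "integrable P (\<lambda>\<omega>. (rate n * (active k \<omega> + idle k \<omega>))\<^sup>2)"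
    unfolding power_mult_distrib
    by (intro integrable_mult_right integrable_square_add)
      (simp_all add: active_square_integrable idle_square_integrable)
  have "integrable P (\<lambda>\<omega>. (rate n * (active k \<omega> + idle k \<omega>) + (- served n k \<omega>))\<^sup>2)"
    by (rule integrable_square_add[OF _ _ sum_sq]) (simp_all add: served_square_integrable)
  then show ?thesis by (simp add: net_arrival_def)
qed

lemma net_integrable: "integrable P (X n k)"
  by (rule square_integrable_imp_integrable[OF net_arrival_measurable net_square_integrable])

lemma queue_square_integrable: "integrable P (\<lambda>\<omega>. (Q n k \<omega>)\<^sup>2)"
proof (induction k)
  case (Suc k)
  have "integrable P (\<lambda>\<omega>. (Q n k \<omega> + X n k \<omega>)\<^sup>2)"
    by (rule integrable_square_add[OF _ _ Suc net_square_integrable]) measurable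
  then show ?case
  proof (rule Bochner_Integration.integrable_bound)
    have "(max y 0)\<^sup>2 \<le> y\<^sup>2" for y :: real by (cases "0 \<le> y") auto
    then show "AE \<omega> in P. norm ((Q n (Suc k) \<omega>)\<^sup>2) \<le> norm ((Q n k \<omega> + X n k \<omega>)\<^sup>2)" by simp
  qed measurable
qed simp

lemma queue_integrable: "integrable P (Q n k)"
  by (rule square_integrable_imp_integrable[OF queue_measurable queue_square_integrable])

lemma queue_vector_measurable:
  "(\<lambda>\<omega>. \<lambda>n\<in>classes S. Q n k \<omega>) \<in> P \<rightarrow>\<^sub>M Pi\<^sub>M (classes S) (\<lambda>_. borel)"
  by (rule measurable_restrict) measurable

lemma subalgebra_queue_info: "subalgebra P (queue_info S rate Q0 k)"
  unfolding subalgebra_def queue_info_def space_P[symmetric]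
  by (subst sets_vimage_algebra2)
    (use measurable_space[OF queue_vector_measurable] measurable_sets[OF queue_vector_measurable] in auto)

text \<open>Taking expectations in the almost sure bound removes the conditioning on the queue
  vector; the 2 is the factor 1/2 of \<open>drift_bound\<close> moved across.\<close>

lemma net_square_sum_le: "(\<Sum>n\<in>classes S. \<integral>\<omega>. (X n k \<omega>)\<^sup>2 \<partial>P) \<le> 2 * B"
proof -
  interpret qi: finite_measure_subalgebra P "queue_info S rate Q0 k"
    by unfold_locales (rule subalgebra_queue_info)
  let ?c = "\<lambda>n. real_cond_exp P (queue_info S rate Q0 k) (\<lambda>\<omega>. (X n k \<omega>)\<^sup>2)"
  have int: "integrable P (?c n)" and eq: "(\<integral>\<omega>. ?c n \<omega> \<partial>P) = (\<integral>\<omega>. (X n k \<omega>)\<^sup>2 \<partial>P)" for n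
    using qi.real_cond_exp_int[OF net_square_integrable] by auto
  have "AE \<omega> in P. 1 / 2 * (\<Sum>n\<in>classes S. ?c n \<omega>) \<le> B"
    using drift policy by (simp add: drift_bound_def)
  then have "(\<integral>\<omega>. 1 / 2 * (\<Sum>n\<in>classes S. ?c n \<omega>) \<partial>P) \<le> (\<integral>\<omega>. B \<partial>P)"
    by (intro integral_mono_AE integrable_mult_right Bochner_Integration.integrable_sum int) auto
  also have "(\<integral>\<omega>. 1 / 2 * (\<Sum>n\<in>classes S. ?c n \<omega>) \<partial>P)
      = 1 / 2 * (\<Sum>n\<in>classes S. \<integral>\<omega>. (X n k \<omega>)\<^sup>2 \<partial>P)"
    using int by (simp add: eq Bochner_Integration.integral_sum)
  finally show ?thesis by (simp add: prob_space)
qed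

lemma net_square_le: "n \<in> classes S \<Longrightarrow> (\<integral>\<omega>. (X n k \<omega>)\<^sup>2 \<partial>P) \<le> 2 * B"
  using member_le_sum[of n "classes S" "\<lambda>n. \<integral>\<omega>. (X n k \<omega>)\<^sup>2 \<partial>P"] net_square_sum_le[of k] finite_classes
  by fastforce

text \<open>The index of the chosen action is itself a lower bound for all indices at the observed
  queues. So \<open>index_bound_power_opt\<close> applies with this index as \<theta> and the
  current queues as \<open>q\<close>, and multiplication by the conditional mean frame size gives
  the claim.\<close>

lemma frame_inequality:
  "AE \<omega> in P. V * cond_energy k \<omega>
      + (\<Sum>n\<in>classes S. Q n k \<omega> * (rate n * (cond_active k \<omega> + idle k \<omega>) - served n k \<omega>))
    \<le> V * p_opt * (cond_active k \<omega> + idle k \<omega>)"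
  using algorithm cond_active_ge AE_space
proof eventually_elim
  case (elim \<omega>)
  let ?q = "\<lambda>n. Q n k \<omega>"
  let ?T = "cond_active k \<omega> + idle k \<omega>"
  have T: "0 < ?T"
    using elim(2) idle_nonneg[OF elim(3), of k] min_active_pos by (smt (verit))
  have "scheduling_index S V ?q (chosen k \<omega>) \<le> scheduling_index S V ?q a" if "a \<in> choices S" for a
    using elim(1) that unfolding is_arg_min_linorder by blast
  then have "scheduling_index S V ?q (chosen k \<omega>) \<le> V * p_opt - (\<Sum>n\<in>classes S. ?q n * rate n)"
    by (intro index_bound_power_opt[OF system feas V_nonneg]) (auto intro: queue_nonneg)
  then have "V * cond_energy k \<omega> - (\<Sum>n\<in>classes S. ?q n * served n k \<omega>)
      \<le> (V * p_opt - (\<Sum>n\<in>classes S. ?q n * rate n)) * ?T"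
    using T queue_of_chosen_class[OF elim(3), of ?q k]
    by (simp add: scheduling_index_chosen pos_divide_le_eq)
  moreover have "(\<Sum>n\<in>classes S. ?q n * (rate n * ?T - served n k \<omega>))
      = (\<Sum>n\<in>classes S. ?q n * rate n) * ?T - (\<Sum>n\<in>classes S. ?q n * served n k \<omega>)"
    by (simp add: right_diff_distrib sum_subtractf sum_distrib_right mult.assoc)
  ultimately show ?case
    by (simp add: left_diff_distrib)
qed

section \<open>Expectations of the terms of one frame\<close>

lemma expectation_cond_active: "(\<integral>\<omega>. cond_active k \<omega> \<partial>P) = (\<integral>\<omega>. active k \<omega> \<partial>P)"
  and expectation_cond_energy: "(\<integral>\<omega>. cond_energy k \<omega> \<partial>P) = (\<integral>\<omega>. energy k \<omega> \<partial>P)"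
  using expectation_mult_outcome[of "\<lambda>_. 1" k fst] expectation_mult_outcome[of "\<lambda>_. 1" k snd]
    active_integrable[of k] energy_integrable[of k]
  by (simp_all add: active_as_outcome energy_as_outcome)

lemma queue_active_integrable: "integrable P (\<lambda>\<omega>. Q n k \<omega> * active k \<omega>)"
  and queue_idle_integrable: "integrable P (\<lambda>\<omega>. Q n k \<omega> * idle k \<omega>)"
  and queue_served_integrable: "integrable P (\<lambda>\<omega>. Q n k \<omega> * served n k \<omega>)"
  and queue_net_integrable: "integrable P (\<lambda>\<omega>. Q n k \<omega> * X n k \<omega>)"
  by (rule integrable_mult_of_squares;
      simp add: queue_square_integrable active_square_integrable idle_square_integrable
        served_square_integrable net_square_integrable)+

lemma queue_cond_active_integrable: "integrable P (\<lambda>\<omega>. Q n k \<omega> * cond_active k \<omega>)"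
  by (rule integrable_mult_outcome_mean[OF queue_integrable])

lemma expectation_queue_active:
  "(\<integral>\<omega>. Q n k \<omega> * active k \<omega> \<partial>P) = (\<integral>\<omega>. Q n k \<omega> * cond_active k \<omega> \<partial>P)"
  using expectation_mult_outcome[OF queue_info[of rate Q0 n k] fst_outcome_measurable]
    active_integrable[of k] queue_active_integrable[of n k]
  by (simp add: active_as_outcome)

text \<open>Idle time and service belong to the choice, so the active time is the only term to be
  exchanged for its conditional mean.\<close>

lemma expectation_queue_net:
  "(\<integral>\<omega>. Q n k \<omega> * X n k \<omega> \<partial>P)
    = (\<integral>\<omega>. Q n k \<omega> * (rate n * (cond_active k \<omega> + idle k \<omega>) - served n k \<omega>) \<partial>P)"
proof -
  have l: "Q n k \<omega> * X n k \<omega>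
      = rate n * (Q n k \<omega> * active k \<omega> + Q n k \<omega> * idle k \<omega>) - Q n k \<omega> * served n k \<omega>" for \<omega>
    by (simp add: net_arrival_def algebra_simps)
  have r: "Q n k \<omega> * (rate n * (cond_active k \<omega> + idle k \<omega>) - served n k \<omega>)
      = rate n * (Q n k \<omega> * cond_active k \<omega> + Q n k \<omega> * idle k \<omega>) - Q n k \<omega> * served n k \<omega>" for \<omega>
    by (simp add: algebra_simps)
  show ?thesis
    unfolding l r
    using queue_active_integrable queue_idle_integrable queue_served_integrable queue_cond_active_integrable
    by (simp add: expectation_queue_active)
qed

text \<open>The quantity that \<beta> bounds in the final theorem; it enters the drift with weight
  \<open>V\<close>.\<close>

definition slack :: "nat \<Rightarrow> real" where
  "slack k = (\<integral>\<omega>. p_opt * (active k \<omega> + idle k \<omega>) - energy k \<omega> \<partial>P)"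

lemma slack_eq:
  "slack k = p_opt * ((\<integral>\<omega>. active k \<omega> \<partial>P) + (\<integral>\<omega>. idle k \<omega> \<partial>P)) - (\<integral>\<omega>. energy k \<omega> \<partial>P)"
  unfolding slack_def using active_integrable idle_integrable energy_integrable by simp

lemma expected_frame_inequality:
  "(\<Sum>n\<in>classes S. \<integral>\<omega>. Q n k \<omega> * X n k \<omega> \<partial>P) \<le> V * slack k"
proof -
  let ?R = "\<lambda>n \<omega>. Q n k \<omega> * (rate n * (cond_active k \<omega> + idle k \<omega>) - served n k \<omega>)"
  have "?R n = (\<lambda>\<omega>. rate n * (Q n k \<omega> * cond_active k \<omega> + Q n k \<omega> * idle k \<omega>) - Q n k \<omega> * served n k \<omega>)" for n
    by (simp add: algebra_simps)
  then have R: "integrable P (?R n)" for n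
    using queue_idle_integrable queue_served_integrable queue_cond_active_integrable by simp
  note int = R integrable_outcome_mean idle_integrable
  have "(\<integral>\<omega>. V * cond_energy k \<omega> + (\<Sum>n\<in>classes S. ?R n \<omega>) \<partial>P)
      \<le> (\<integral>\<omega>. V * p_opt * (cond_active k \<omega> + idle k \<omega>) \<partial>P)"
    by (rule integral_mono_AE[OF _ _ frame_inequality]) (use int in auto)
  moreover have "(\<integral>\<omega>. V * cond_energy k \<omega> + (\<Sum>n\<in>classes S. ?R n \<omega>) \<partial>P)
      = V * (\<integral>\<omega>. energy k \<omega> \<partial>P) + (\<Sum>n\<in>classes S. \<integral>\<omega>. Q n k \<omega> * X n k \<omega> \<partial>P)"
    unfolding expectation_queue_net expectation_cond_energy[symmetric]
    using int by (simp add: Bochner_Integration.integral_sum)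
  moreover have "(\<integral>\<omega>. V * p_opt * (cond_active k \<omega> + idle k \<omega>) \<partial>P)
      = V * p_opt * ((\<integral>\<omega>. active k \<omega> \<partial>P) + (\<integral>\<omega>. idle k \<omega> \<partial>P))"
    unfolding expectation_cond_active[symmetric] using int by simp
  moreover have "V * slack k
      = V * p_opt * ((\<integral>\<omega>. active k \<omega> \<partial>P) + (\<integral>\<omega>. idle k \<omega> \<partial>P)) - V * (\<integral>\<omega>. energy k \<omega> \<partial>P)"
    by (simp add: slack_eq right_diff_distrib)
  ultimately show ?thesis by linarith
qed

section \<open>Quadratic Lyapunov drift and its telescoped form\<close>

definition lyapunov :: "nat \<Rightarrow> real" where
  "lyapunov k = (\<Sum>n\<in>classes S. \<integral>\<omega>. (Q n k \<omega>)\<^sup>2 \<partial>P)"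

lemma lyapunov_nonneg: "0 \<le> lyapunov k"
  unfolding lyapunov_def by (intro sum_nonneg) simp

text \<open>Truncation at zero can only decrease the square of \<open>Q + X\<close>. In its
  expansion the squared increments are controlled by \<open>B\<close> and the cross terms by
  \<open>expected_frame_inequality\<close>. Both appear doubled because \<open>lyapunov\<close>
  carries no factor 1/2.\<close>

lemma lyapunov_drift: "lyapunov (Suc k) \<le> lyapunov k + 2 * B + 2 * V * slack k"
proof -
  have "(\<integral>\<omega>. (Q n (Suc k) \<omega>)\<^sup>2 \<partial>P)
      \<le> (\<integral>\<omega>. (Q n k \<omega>)\<^sup>2 \<partial>P) + 2 * (\<integral>\<omega>. Q n k \<omega> * X n k \<omega> \<partial>P) + (\<integral>\<omega>. (X n k \<omega>)\<^sup>2 \<partial>P)" for n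
  proof -
    note int = queue_square_integrable queue_net_integrable net_square_integrable
    have "(max y 0)\<^sup>2 \<le> y\<^sup>2" for y :: real by (cases "0 \<le> y") auto
    then have "(Q n (Suc k) \<omega>)\<^sup>2 \<le> (Q n k \<omega>)\<^sup>2 + 2 * (Q n k \<omega> * X n k \<omega>) + (X n k \<omega>)\<^sup>2" for \<omega>
      using power2_sum[of "Q n k \<omega>" "X n k \<omega>"] by (simp add: algebra_simps) (metis add.commute)
    then have "(\<integral>\<omega>. (Q n (Suc k) \<omega>)\<^sup>2 \<partial>P)
        \<le> (\<integral>\<omega>. (Q n k \<omega>)\<^sup>2 + 2 * (Q n k \<omega> * X n k \<omega>) + (X n k \<omega>)\<^sup>2 \<partial>P)"
      by (intro integral_mono int Bochner_Integration.integrable_add integrable_mult_right)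
    also have "\<dots> = (\<integral>\<omega>. (Q n k \<omega>)\<^sup>2 \<partial>P) + 2 * (\<integral>\<omega>. Q n k \<omega> * X n k \<omega> \<partial>P) + (\<integral>\<omega>. (X n k \<omega>)\<^sup>2 \<partial>P)"
      using int by simp
    finally show ?thesis .
  qed
  then have "lyapunov (Suc k) \<le> (\<Sum>n\<in>classes S. (\<integral>\<omega>. (Q n k \<omega>)\<^sup>2 \<partial>P)
      + 2 * (\<integral>\<omega>. Q n k \<omega> * X n k \<omega> \<partial>P) + (\<integral>\<omega>. (X n k \<omega>)\<^sup>2 \<partial>P))"
    unfolding lyapunov_def by (rule sum_mono)
  also have "\<dots> = lyapunov k + 2 * (\<Sum>n\<in>classes S. \<integral>\<omega>. Q n k \<omega> * X n k \<omega> \<partial>P)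
      + (\<Sum>n\<in>classes S. \<integral>\<omega>. (X n k \<omega>)\<^sup>2 \<partial>P)"
    by (simp add: lyapunov_def sum.distrib sum_distrib_left)
  also have "\<dots> \<le> lyapunov k + 2 * (V * slack k) + 2 * B"
    using expected_frame_inequality[of k] net_square_sum_le[of k] by simp
  finally show ?thesis by simp
qed

lemma lyapunov_le: "lyapunov K \<le> 2 * (real K * B + V * (\<Sum>k<K. slack k))"
proof (induction K)
  case 0
  then show ?case by (simp add: lyapunov_def Q0_zero)
next
  case (Suc K)
  then show ?case using lyapunov_drift[of K] by (simp add: algebra_simps)
qed

text \<open>First moments are bounded by roots of second moments, uniformly in the frame. Besides
  being claimed in the theorem, the existence of some \<beta> is needed for the rate constraints,
  whose statements do not mention it.\<close>

lemma slack_bounded: "\<exists>\<beta>. \<forall>k. slack k \<le> \<beta>"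
proof (intro exI allI)
  fix k
  have root: "\<bar>\<integral>\<omega>. Y \<omega> \<partial>P\<bar> \<le> sqrt (moment_bound S)"
    if [measurable]: "Y \<in> borel_measurable P" and "integrable P (\<lambda>\<omega>. (Y \<omega>)\<^sup>2)"
      and "(\<integral>\<omega>. (Y \<omega>)\<^sup>2 \<partial>P) \<le> moment_bound S" for Y :: "'m path \<Rightarrow> real"
  proof -
    have "\<bar>\<integral>\<omega>. Y \<omega> \<partial>P\<bar> \<le> (\<integral>\<omega>. \<bar>Y \<omega>\<bar> \<partial>P)" by (rule integral_abs_bound)
    also have "\<dots> \<le> sqrt (\<integral>\<omega>. (Y \<omega>)\<^sup>2 \<partial>P)" by (rule expectation_abs_le_square[OF that(1,2)])
    also have "\<dots> \<le> sqrt (moment_bound S)" using that(3) by simp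
    finally show ?thesis .
  qed
  have "\<bar>\<integral>\<omega>. idle k \<omega> \<partial>P\<bar> \<le> max_idle S"
  proof -
    have "\<bar>\<integral>\<omega>. idle k \<omega> \<partial>P\<bar> \<le> (\<integral>\<omega>. \<bar>idle k \<omega>\<bar> \<partial>P)" by (rule integral_abs_bound)
    also have "\<dots> \<le> (\<integral>\<omega>. max_idle S \<partial>P)"
      by (rule integral_mono) (simp_all add: idle_integrable idle_le idle_nonneg)
    finally show ?thesis by (simp add: prob_space)
  qed
  then have "\<bar>(\<integral>\<omega>. active k \<omega> \<partial>P) + (\<integral>\<omega>. idle k \<omega> \<partial>P)\<bar> \<le> sqrt (moment_bound S) + max_idle S"
    using root[OF active_measurable active_square_integrable active_square_le, of k] by linarith
  then have "\<bar>p_opt * ((\<integral>\<omega>. active k \<omega> \<partial>P) + (\<integral>\<omega>. idle k \<omega> \<partial>P))\<bar>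
      \<le> \<bar>p_opt\<bar> * (sqrt (moment_bound S) + max_idle S)"
    unfolding abs_mult by (rule mult_left_mono) simp
  moreover have "\<bar>\<integral>\<omega>. energy k \<omega> \<partial>P\<bar> \<le> sqrt (moment_bound S)"
    by (rule root[OF energy_measurable energy_square_integrable energy_square_le])
  ultimately show "slack k \<le> \<bar>p_opt\<bar> * (sqrt (moment_bound S) + max_idle S) + sqrt (moment_bound S)"
    unfolding slack_eq by linarith
qed

lemma lyapunov_le_linear:
  assumes "\<And>k. slack k \<le> \<beta>"
  shows "lyapunov K \<le> real K * (2 * (B + V * \<beta>))"
proof -
  have "(\<Sum>k<K. slack k) \<le> real K * \<beta>"
    using sum_bounded_above[of "{..<K}" slack \<beta>] assms by simp
  then have "V * (\<Sum>k<K. slack k) \<le> V * (real K * \<beta>)"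
    using V_nonneg by (rule mult_left_mono)
  then show ?thesis using lyapunov_le[of K] by (simp add: algebra_simps)
qed

lemma queue_square_le_lyapunov: "n \<in> classes S \<Longrightarrow> (\<integral>\<omega>. (Q n K \<omega>)\<^sup>2 \<partial>P) \<le> lyapunov K"
  unfolding lyapunov_def using finite_classes by (intro member_le_sum) auto

section \<open>The power bound\<close>

lemma mean_frame_pos:
  assumes "K \<ge> 1"
  shows "0 < mean_avg P active K + mean_avg P idle K"
proof -
  have "min_active S = (\<integral>\<omega>. min_active S \<partial>P)" by (simp add: prob_space)
  also have "\<dots> \<le> (\<integral>\<omega>. active k \<omega> \<partial>P)" for k
    by (rule integral_mono) (simp_all add: active_integrable active_ge)
  finally have "avg K (\<lambda>_. min_active S) \<le> mean_avg P active K"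
    unfolding mean_avg_def by (rule avg_mono)
  moreover have "avg K (\<lambda>_. 0) \<le> mean_avg P idle K"
    unfolding mean_avg_def
    by (rule avg_mono, rule integral_nonneg_AE, rule AE_I2, rule idle_nonneg)
  ultimately show ?thesis using min_active_pos assms by (simp add: avg_const)
qed

text \<open>As \<open>lyapunov K\<close> is nonnegative, its telescoped upper bound is too. That
  bounds the average slack below by \<open>- B / V\<close>, and the average slack is the optimal
  power times the mean frame size minus the mean energy.\<close>

lemma power_bound:
  assumes "0 < V" and K: "K \<ge> 1"
  shows "mean_avg P energy K / (mean_avg P active K + mean_avg P idle K)
    \<le> p_opt + B / (V * (mean_avg P active K + mean_avg P idle K))"
proof -
  let ?T = "mean_avg P active K + mean_avg P idle K"
  have T: "0 < ?T" by (rule mean_frame_pos[OF K])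
  have "0 \<le> 2 * (real K * B + V * (\<Sum>k<K. slack k))"
    by (rule order_trans[OF lyapunov_nonneg lyapunov_le])
  then have "0 \<le> real K * B + V * (\<Sum>k<K. slack k)"
    by simp
  moreover have "(\<Sum>k<K. slack k) = real K * avg K slack"
    using K by (simp add: avg_def)
  ultimately have "0 \<le> real K * (B + V * avg K slack)"
    by (simp add: algebra_simps)
  then have "0 \<le> B + V * avg K slack"
    using K by (simp add: zero_le_mult_iff)
  also have "avg K slack = p_opt * ?T - mean_avg P energy K"
    unfolding slack_eq[abs_def] by (simp add: avg_diff avg_add avg_cmult mean_avg_def)
  finally have "V * mean_avg P energy K \<le> V * (p_opt * ?T) + B"
    by (simp add: algebra_simps)
  then have "mean_avg P energy K \<le> p_opt * ?T + B / V"
    using \<open>0 < V\<close> by (simp add: field_simps)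
  then have "mean_avg P energy K / ?T \<le> (p_opt * ?T + B / V) / ?T"
    using T by (simp add: divide_right_mono)
  also have "\<dots> = p_opt + B / (V * ?T)"
    using T by (simp add: add_divide_distrib)
  finally show ?thesis .
qed

section \<open>Growth of the norm of the queue vector\<close>

lemma queue_norm_square: "(queue_norm S rate Q0 K \<omega>)\<^sup>2 = (\<Sum>n\<in>classes S. (Q n K \<omega>)\<^sup>2)"
  by (simp add: queue_norm_def sum_nonneg)

text \<open>The second moment of the norm is exactly \<open>lyapunov K\<close>, which grows at most
  linearly, so the first moment grows at most like the root of \<open>K\<close>.\<close>

lemma queue_norm_bound:
  assumes \<beta>: "\<And>k. slack k \<le> \<beta>" and K: "K \<ge> 1"
  shows "integrable P (queue_norm S rate Q0 K)"
    and "(\<integral>\<omega>. queue_norm S rate Q0 K \<omega> \<partial>P) / real K \<le> sqrt (2 * (B + V * \<beta>) / real K)"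
proof -
  have meas: "queue_norm S rate Q0 K \<in> borel_measurable P"
    unfolding queue_norm_def[abs_def] by measurable
  have sq: "integrable P (\<lambda>\<omega>. (queue_norm S rate Q0 K \<omega>)\<^sup>2)"
    unfolding queue_norm_square by (intro Bochner_Integration.integrable_sum queue_square_integrable)
  show "integrable P (queue_norm S rate Q0 K)"
    by (rule square_integrable_imp_integrable[OF meas sq])
  have "(\<integral>\<omega>. (queue_norm S rate Q0 K \<omega>)\<^sup>2 \<partial>P) = lyapunov K"
    unfolding queue_norm_square lyapunov_def
    by (intro Bochner_Integration.integral_sum queue_square_integrable)
  then have "(\<integral>\<omega>. \<bar>queue_norm S rate Q0 K \<omega>\<bar> \<partial>P) \<le> sqrt (lyapunov K)"
    using expectation_abs_le_square[OF meas sq] by simp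
  then have "(\<integral>\<omega>. queue_norm S rate Q0 K \<omega> \<partial>P) \<le> sqrt (lyapunov K)"
    by (simp add: queue_norm_def sum_nonneg)
  also have "\<dots> \<le> sqrt (real K * (2 * (B + V * \<beta>)))"
    using lyapunov_le_linear[OF \<beta>] by (rule real_sqrt_le_mono)
  \<comment> \<open>Writing the divisor \<open>K\<close> as the root of its square lets the quotient
    be gathered under one root.\<close>
  finally have "(\<integral>\<omega>. queue_norm S rate Q0 K \<omega> \<partial>P) / real K \<le> sqrt (real K * (2 * (B + V * \<beta>))) / sqrt ((real K)\<^sup>2)"
    by (simp add: divide_right_mono)
  also have "\<dots> = sqrt (2 * (B + V * \<beta>) / real K)"
    unfolding real_sqrt_divide[symmetric] using K by (simp add: power2_eq_square)
  finally show "(\<integral>\<omega>. queue_norm S rate Q0 K \<omega> \<partial>P) / real K \<le> sqrt (2 * (B + V * \<beta>) / real K)" .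
qed

section \<open>Rate constraints\<close>

lemma net_sum_le_queue: "n \<in> classes S \<Longrightarrow> (\<Sum>k<K. X n k \<omega>) \<le> Q n K \<omega>"
  by (induction K) (auto simp: Q0_zero)

text \<open>Truncation at zero can only raise a queue, so one that starts empty dominates the
  accumulated net arrivals. Both rate constraints thereby reduce to sublinear growth of the
  queue.\<close>

lemma net_avg_le_queue: "n \<in> classes S \<Longrightarrow> avg K (\<lambda>k. X n k \<omega>) \<le> Q n K \<omega> / real K"
  using net_sum_le_queue by (simp add: avg_def divide_right_mono)

text \<open>Second moments of the queue grow linearly by \<open>lyapunov_le_linear\<close> and those
  of its increments are at most \<open>2 * B\<close>, which is the input of
  \<open>AE_sublinear_of_square_moments\<close>.\<close>

lemma pathwise_rate_constraint:
  assumes n: "n \<in> classes S"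
  shows "AE \<omega> in P. limsup (\<lambda>K. ereal (avg K (\<lambda>k. X n k \<omega>))) \<le> 0"
proof -
  obtain \<beta> where \<beta>: "\<And>k. slack k \<le> \<beta>" using slack_bounded by blast
  have "AE \<omega> in P. (\<lambda>K. Q n K \<omega> / real K) \<longlonglongrightarrow> 0"
  proof (rule AE_sublinear_of_square_moments[OF queue_measurable net_arrival_measurable
        queue_square_integrable _ net_square_integrable net_square_le[OF n] queue_nonneg[OF n]])
    show "(\<integral>\<omega>. (Q n K \<omega>)\<^sup>2 \<partial>P) \<le> real K * (2 * (B + V * \<beta>))" for K
      using queue_square_le_lyapunov[OF n] lyapunov_le_linear[OF \<beta>] by (rule order_trans)
    show "Q n (Suc k) \<omega> \<le> Q n k \<omega> + \<bar>X n k \<omega>\<bar>" for k \<omega>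
      using queue_nonneg[OF n, of k \<omega>] by simp
  qed
  then show ?thesis
    by eventually_elim (rule limsup_le_zero[OF net_avg_le_queue[OF n]])
qed

text \<open>The expected average net arrival is at most the expected queue norm divided by
  \<open>K\<close>, which decays like the inverse root of \<open>K\<close>.\<close>

lemma mean_rate_constraint:
  assumes n: "n \<in> classes S"
  shows "limsup (\<lambda>K. ereal (rate n * (mean_avg P active K + mean_avg P idle K)
    - mean_avg P (served n) K)) \<le> 0"
proof -
  obtain \<beta> where \<beta>: "\<And>k. slack k \<le> \<beta>" using slack_bounded by blast
  have eq: "rate n * (mean_avg P active K + mean_avg P idle K) - mean_avg P (served n) K
      = (\<integral>\<omega>. avg K (\<lambda>k. X n k \<omega>) \<partial>P)" for K
  proof -
    have "(\<integral>\<omega>. X n k \<omega> \<partial>P)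
        = rate n * ((\<integral>\<omega>. active k \<omega> \<partial>P) + (\<integral>\<omega>. idle k \<omega> \<partial>P)) - (\<integral>\<omega>. served n k \<omega> \<partial>P)" for k
      unfolding net_arrival_def using active_integrable idle_integrable served_integrable by simp
    then have "rate n * (mean_avg P active K + mean_avg P idle K) - mean_avg P (served n) K
        = avg K (\<lambda>k. \<integral>\<omega>. X n k \<omega> \<partial>P)"
      by (simp add: mean_avg_def avg_diff avg_add avg_cmult)
    also have "\<dots> = (\<integral>\<omega>. avg K (\<lambda>k. X n k \<omega>) \<partial>P)"
      unfolding avg_def using net_integrable by (simp add: Bochner_Integration.integral_sum)
    finally show ?thesis .
  qed
  have "(\<integral>\<omega>. avg K (\<lambda>k. X n k \<omega>) \<partial>P) \<le> sqrt (2 * (B + V * \<beta>) / real K)" for K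
  \<comment> \<open>\<open>limsup_le_zero\<close> asks for the bound at every \<open>K\<close>; at
    \<open>K = 0\<close> both sides are 0 because division by zero yields 0.\<close>
  proof (cases "K = 0")
    case True
    then show ?thesis by (simp add: avg_def)
  next
    case False
    then have K: "K \<ge> 1" by simp
    note norm = queue_norm_bound[OF \<beta> K]
    have avg_int: "integrable P (\<lambda>\<omega>. avg K (\<lambda>k. X n k \<omega>))"
      unfolding avg_def using net_integrable by simp
    have "Q n K \<omega> \<le> queue_norm S rate Q0 K \<omega>" for \<omega>
      unfolding queue_norm_def
      by (intro real_le_rsqrt member_le_sum[of n "classes S" "\<lambda>n. (Q n K \<omega>)\<^sup>2"])
        (use n finite_classes in auto)
    then have "avg K (\<lambda>k. X n k \<omega>) \<le> queue_norm S rate Q0 K \<omega> / real K" for \<omega>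
      using net_avg_le_queue[OF n, of K \<omega>] by (meson divide_right_mono of_nat_0_le_iff order_trans)
    then have "(\<integral>\<omega>. avg K (\<lambda>k. X n k \<omega>) \<partial>P) \<le> (\<integral>\<omega>. queue_norm S rate Q0 K \<omega> / real K \<partial>P)"
      by (intro integral_mono avg_int integrable_divide norm(1))
    also have "\<dots> \<le> sqrt (2 * (B + V * \<beta>) / real K)"
      using norm(2) by simp
    finally show ?thesis .
  qed
  moreover have "(\<lambda>K. sqrt (2 * (B + V * \<beta>) / real K)) \<longlonglongrightarrow> 0"
    using tendsto_real_sqrt[OF lim_const_over_n[of "2 * (B + V * \<beta>)"]] by simp
  ultimately show ?thesis
    unfolding eq by (rule limsup_le_zero)
qed

end

theorem theorem1:
  fixes S :: "'m task_system" and rate Q0 :: "nat \<Rightarrow> real" and V B :: real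
    and P :: "'m path measure"
  assumes "task_system S"
    and "\<forall>n\<in>classes S. Q0 n = 0"
    and "feasible S rate"
    and "drift_bound S rate Q0 B"
    and "V \<ge> 0"
    and "scheduling_policy S rate Q0 V P"
  shows
    "(V > 0 \<longrightarrow>
       (\<forall>K\<ge>1. mean_avg P energy K / (mean_avg P active K + mean_avg P idle K)
          \<le> power_opt S rate + B / (V * (mean_avg P active K + mean_avg P idle K)))) \<and>
     (\<forall>n\<in>classes S.
       (AE \<omega> in P. limsup (\<lambda>K. ereal (avg K
          (\<lambda>k. rate n * (active k \<omega> + idle k \<omega>) - served n k \<omega>))) \<le> 0) \<and>
       limsup (\<lambda>K. ereal (rate n * (mean_avg P active K + mean_avg P idle K)
          - mean_avg P (served n) K)) \<le> 0) \<and>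
     (\<exists>\<beta>. \<forall>k. (\<integral>\<omega>. power_opt S rate * (active k \<omega> + idle k \<omega>) - energy k \<omega> \<partial>P) \<le> \<beta>) \<and>
     (\<forall>\<beta>. (\<forall>k. (\<integral>\<omega>. power_opt S rate * (active k \<omega> + idle k \<omega>) - energy k \<omega> \<partial>P) \<le> \<beta>) \<longrightarrow>
       (\<forall>K\<ge>1. integrable P (queue_norm S rate Q0 K) \<and>
          (\<integral>\<omega>. queue_norm S rate Q0 K \<omega> \<partial>P) / real K \<le> sqrt (2 * (B + V * \<beta>) / real K)))"
proof -
  have pol: "policy S P" using assms(6) by (simp add: scheduling_policy_def)
  interpret task_policy P S
    using assms(1) pol by (simp add: task_policy_def task_policy_axioms_def policy_def)
  interpret scheduling P S rate Q0 V B
    by unfold_locales (use assms in \<open>auto simp: scheduling_policy_def\<close>)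
  show ?thesis
    unfolding net_arrival_def[symmetric] slack_def[symmetric]
    using power_bound pathwise_rate_constraint mean_rate_constraint slack_bounded queue_norm_bound
    by blast
qed

end
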